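(* Let $M$ be an oriented matroid on a linearly ordered finite set $E$. Then $$t(M;x+u,y+v)=\sum_{A\subseteq E}x^{|\Theta^*_M(A)|}\,u^{|\bar\Theta^*_M(A)|}\,y^{|\Theta_M(A)|}\,v^{|\bar\Theta_M(A)|}.$$
   Context: $t(M;x,y)$ is the Tutte polynomial of (the underlying matroid of) $M$. For $A\subseteq E$, $-_AM$ is the oriented matroid obtained from $M$ by reorienting $A$. Signed circuits and cocircuits come in opposite pairs; one is positive if all its signs are positive. For an ordered oriented matroid $N$, $O(N)$ is the set of smallest elements of positive circuits of $N$, and $O^*(N)$ is the set of smallest elements of positive cocircuits of $N$. For $A\subseteq E$: $\Theta_M(A)=O(-_AM)\setminus A$, $\bar\Theta_M(A)=O(-_AM)\cap A$, $\Theta^*_M(A)=O^*(-_AM)\setminus A$, $\bar\Theta^*_M(A)=O^*(-_AM)\cap A$. *)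

theory Defs
  imports Main
begin

text \<open>A signed set is encoded as the pair (positive part, negative part).\<close>

type_synonym 'a signed_set = "'a set \<times> 'a set"

definition support :: "'a signed_set \<Rightarrow> 'a set" where
  "support X = fst X \<union> snd X"

definition opposite :: "'a signed_set \<Rightarrow> 'a signed_set" where
  "opposite X = (snd X, fst X)"

definition signed_set_on :: "'a set \<Rightarrow> 'a signed_set \<Rightarrow> bool" where
  "signed_set_on E X \<longleftrightarrow> support X \<subseteq> E \<and> fst X \<inter> snd X = {}"

definition orthogonal :: "'a signed_set \<Rightarrow> 'a signed_set \<Rightarrow> bool" where
  "orthogonal X Y \<longleftrightarrow>
     support X \<inter> support Y = {} \<or>
     ((fst X \<inter> fst Y) \<union> (snd X \<inter> snd Y) \<noteq> {} \<and> (fst X \<inter> snd Y) \<union> (snd X \<inter> fst Y) \<noteq> {})"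

definition flip :: "'a set \<Rightarrow> 'a signed_set \<Rightarrow> 'a signed_set" where
  "flip A X = ((fst X - A) \<union> (snd X \<inter> A), (snd X - A) \<union> (fst X \<inter> A))"

record 'a signed_system =
  ground :: "'a set"
  circuits :: "'a signed_set set"

text \<open>The signed circuit axioms of an oriented matroid; the last clause is weak elimination.\<close>

definition oriented_matroid :: "'a signed_system \<Rightarrow> bool" where
  "oriented_matroid M \<longleftrightarrow>
     finite (ground M) \<and>
     (\<forall>X \<in> circuits M. signed_set_on (ground M) X) \<and>
     (\<forall>X \<in> circuits M. support X \<noteq> {}) \<and>
     (\<forall>X \<in> circuits M. opposite X \<in> circuits M) \<and>
     (\<forall>X \<in> circuits M. \<forall>Y \<in> circuits M.
        support X \<subseteq> support Y \<longrightarrow> X = Y \<or> X = opposite Y) \<and>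
     (\<forall>X \<in> circuits M. \<forall>Y \<in> circuits M. \<forall>e.
        X \<noteq> opposite Y \<and> e \<in> fst X \<inter> snd Y \<longrightarrow>
        (\<exists>Z \<in> circuits M. fst Z \<subseteq> (fst X \<union> fst Y) - {e} \<and> snd Z \<subseteq> (snd X \<union> snd Y) - {e}))"

definition reorient :: "'a set \<Rightarrow> 'a signed_system \<Rightarrow> 'a signed_system" where
  "reorient A M = M\<lparr>circuits := flip A ` circuits M\<rparr>"


subsection \<open>The underlying matroid and its dual\<close>

definition indep :: "'a signed_system \<Rightarrow> 'a set \<Rightarrow> bool" where
  "indep M I \<longleftrightarrow> I \<subseteq> ground M \<and> (\<forall>X \<in> circuits M. \<not> support X \<subseteq> I)"

definition basis :: "'a signed_system \<Rightarrow> 'a set \<Rightarrow> bool" where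
  "basis M B \<longleftrightarrow> indep M B \<and> (\<forall>I. indep M I \<and> B \<subseteq> I \<longrightarrow> I = B)"

definition rank :: "'a signed_system \<Rightarrow> 'a set \<Rightarrow> nat" where
  "rank M A = Max (card ` {I. I \<subseteq> A \<and> indep M I})"

text \<open>Independence in the dual matroid, whose bases are the complements of the bases.\<close>

definition coindep :: "'a signed_system \<Rightarrow> 'a set \<Rightarrow> bool" where
  "coindep M J \<longleftrightarrow> (\<exists>B. basis M B \<and> J \<subseteq> ground M - B)"

definition unsigned_cocircuit :: "'a signed_system \<Rightarrow> 'a set \<Rightarrow> bool" where
  "unsigned_cocircuit M D \<longleftrightarrow>
     D \<subseteq> ground M \<and> \<not> coindep M D \<and> (\<forall>D'. D' \<subset> D \<longrightarrow> coindep M D')"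

text \<open>
  The signed cocircuits are the signatures of the cocircuits of the underlying matroid
  that are orthogonal to all signed circuits. In an oriented matroid every cocircuit of the
  underlying matroid carries exactly two of them, opposite to each other.
\<close>

definition cocircuits :: "'a signed_system \<Rightarrow> 'a signed_set set" where
  "cocircuits M = {Y. signed_set_on (ground M) Y \<and> unsigned_cocircuit M (support Y) \<and>
                      (\<forall>X \<in> circuits M. orthogonal X Y)}"


subsection \<open>The Tutte polynomial\<close>

text \<open>
  The rank generating form of the Tutte polynomial, evaluated in an arbitrary commutative ring;
  the natural number subtractions do not truncate, as the rank is monotone and bounded by the
  cardinality.
\<close>

definition tutte :: "'a signed_system \<Rightarrow> 'r::comm_ring_1 \<Rightarrow> 'r \<Rightarrow> 'r" where
  "tutte M x y = (\<Sum>A \<in> Pow (ground M).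
     (x - 1) ^ (rank M (ground M) - rank M A) * (y - 1) ^ (card A - rank M A))"


subsection \<open>Activities of reorientations\<close>

definition positive :: "'a signed_set \<Rightarrow> bool" where
  "positive X \<longleftrightarrow> snd X = {}"

definition O_act :: "'a::linorder signed_system \<Rightarrow> 'a set" where
  "O_act N = {Min (support X) | X. X \<in> circuits N \<and> positive X}"

definition O_star :: "'a::linorder signed_system \<Rightarrow> 'a set" where
  "O_star N = {Min (support Y) | Y. Y \<in> cocircuits N \<and> positive Y}"

definition Theta :: "'a::linorder signed_system \<Rightarrow> 'a set \<Rightarrow> 'a set" where
  "Theta M A = O_act (reorient A M) - A"

definition Theta_bar :: "'a::linorder signed_system \<Rightarrow> 'a set \<Rightarrow> 'a set" where
  "Theta_bar M A = O_act (reorient A M) \<inter> A"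

definition Theta_star :: "'a::linorder signed_system \<Rightarrow> 'a set \<Rightarrow> 'a set" where
  "Theta_star M A = O_star (reorient A M) - A"

definition Theta_star_bar :: "'a::linorder signed_system \<Rightarrow> 'a set \<Rightarrow> 'a set" where
  "Theta_star_bar M A = O_star (reorient A M) \<inter> A"

end

theory Submission
  imports Defs
begin

text \<open>
  The circuits and cocircuits of an oriented matroid form a pair \<open>(C, D)\<close> of families of signed sets
  that are orthogonal and satisfy Minty's painting property: for every element \<open>e\<close> and every colouring
  of the other elements there is a suitable member of \<open>C\<close> or of \<open>D\<close> through \<open>e\<close>. Such pairs are closed
  under duality and under deletion and contraction, even if one does not restrict to minimal supports.
  Let \<open>w\<close> be the largest element and \<open>A\<close> a set avoiding it. The painting property shows that the
  activities of the pair \<open>A\<close>, \<open>insert w A\<close> of reorientations are nested, in opposite directions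
  for \<open>C\<close> and for \<open>D\<close>; their intersections and unions are the activities of \<open>A\<close> in the deletion and
  in the contraction of \<open>w\<close>. So the sum of weights over all reorientations obeys the
  deletion-contraction recursion of the Tutte polynomial.

  The painting property itself only needs a signature of the complement of every hyperplane \<open>H\<close> that
  is orthogonal to all circuits. The signs come from the circuits inside \<open>B \<union> {d, d'}\<close>, where \<open>B\<close> is a
  basis of \<open>H\<close> and \<open>d\<close>, \<open>d'\<close> lie outside \<open>H\<close>; weak elimination shows that they do not depend on \<open>B\<close>.
\<close>

section \<open>Signs as integers, and spanning by a family of signed sets\<close>

definition sg :: "'a signed_set \<Rightarrow> 'a \<Rightarrow> int" where
  "sg X e = (if e \<in> fst X then 1 else if e \<in> snd X then - 1 else 0)"

lemma sg_cases: "sg X e = 0 \<or> sg X e = 1 \<or> sg X e = - 1"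
  by (simp add: sg_def)

lemma sg_eq_0_iff: "sg X e = 0 \<longleftrightarrow> e \<notin> support X"
  by (auto simp: sg_def support_def)

text \<open>An element in both parts would count as positive; disjoint parts rule this out.\<close>

lemma sg_opposite: "fst X \<inter> snd X = {} \<Longrightarrow> sg (opposite X) e = - sg X e"
  by (auto simp: sg_def opposite_def)

lemma support_opposite [simp]: "support (opposite X) = support X"
  by (auto simp: support_def opposite_def)

text \<open>For the circuits of a matroid and \<open>a\<close> outside \<open>A\<close>, this is
  membership of \<open>a\<close> in the closure of \<open>A\<close>. Since it is read off the family
  directly, it also makes sense for minors whose members do not have minimal support.\<close>

definition spans :: "'a signed_set set \<Rightarrow> 'a set \<Rightarrow> 'a \<Rightarrow> bool" where
  "spans C A a \<longleftrightarrow> (\<exists>X\<in>C. a \<in> support X \<and> support X \<subseteq> insert a A)"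

subsection \<open>The underlying matroid\<close>

locale om =
  fixes M :: "'a signed_system"
  assumes om: "oriented_matroid M"
begin

abbreviation "E \<equiv> ground M"
abbreviation "C \<equiv> circuits M"

definition max_indep_in :: "'a set \<Rightarrow> 'a set \<Rightarrow> bool" where
  "max_indep_in A I \<longleftrightarrow> I \<subseteq> A \<and> indep M I \<and> (\<forall>a\<in>A - I. \<not> indep M (insert a I))"

text \<open>A flat of corank one; the middle clause is closedness.\<close>

definition hyperplane :: "'a set \<Rightarrow> bool" where
  "hyperplane H \<longleftrightarrow> H \<subseteq> E \<and> (\<forall>d\<in>E - H. \<not> spans C H d) \<and> Suc (rank M H) = rank M E"

text \<open>On \<open>E - H\<close> the values are meant as the signs of a cocircuit. The product
  condition is orthogonality to circuits that leave \<open>H\<close> exactly in \<open>d\<close> and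
  \<open>d'\<close>; the product does not change when a circuit is replaced by its opposite.\<close>

definition signature :: "'a set \<Rightarrow> ('a \<Rightarrow> int) \<Rightarrow> bool" where
  "signature H y \<longleftrightarrow> (\<forall>d. y d = 1 \<or> y d = - 1) \<and>
     (\<forall>B d d' X. max_indep_in H B \<longrightarrow> d \<in> E - H \<longrightarrow> d' \<in> E - H \<longrightarrow> d \<noteq> d' \<longrightarrow> X \<in> C \<longrightarrow>
       support X \<subseteq> insert d (insert d' B) \<longrightarrow> sg X d * sg X d' = - (y d * y d'))"

section \<open>Signed circuits and elimination\<close>

lemma finite_E [simp, intro]: "finite E"
  using om by (simp add: oriented_matroid_def)

lemma circuit_support: "X \<in> C \<Longrightarrow> support X \<subseteq> E"
  using om by (auto simp: oriented_matroid_def signed_set_on_def)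

lemma circuit_disjoint: "X \<in> C \<Longrightarrow> fst X \<inter> snd X = {}"
  using om by (auto simp: oriented_matroid_def signed_set_on_def)

lemma circuit_nonempty: "X \<in> C \<Longrightarrow> support X \<noteq> {}"
  using om by (auto simp: oriented_matroid_def)

lemma circuit_opposite: "X \<in> C \<Longrightarrow> opposite X \<in> C"
  using om by (auto simp: oriented_matroid_def)

lemma circuit_incomparable:
  "\<lbrakk>X \<in> C; Y \<in> C; support X \<subseteq> support Y\<rbrakk> \<Longrightarrow> X = Y \<or> X = opposite Y"
  using om unfolding oriented_matroid_def by meson

text \<open>The element \<open>g\<close> certifies that neither circuit is the opposite of the
  other. Whichever of the two is positive at \<open>e\<close> takes the first place in the axiom,
  and the signs of \<open>Z\<close> are inherited pointwise.\<close>

lemma circuit_elimination: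
  assumes "X \<in> C" "Y \<in> C" "sg X e = - sg Y e" "sg X e \<noteq> 0" "sg X g \<noteq> - sg Y g"
  obtains Z where "Z \<in> C" "sg Z e = 0"
    "\<And>f. sg Z f = 0 \<or> sg Z f = sg X f \<or> sg Z f = sg Y f"
proof -
  have weak: "\<exists>Z\<in>C. fst Z \<subseteq> (fst X \<union> fst Y) - {e} \<and> snd Z \<subseteq> (snd X \<union> snd Y) - {e}"
    if "X \<in> C" "Y \<in> C" "X \<noteq> opposite Y" "e \<in> fst X \<inter> snd Y" for X Y
    using om that unfolding oriented_matroid_def by blast
  have X: "X \<noteq> opposite Y"
    using assms(2,5) sg_opposite[OF circuit_disjoint] by metis
  have Y: "Y \<noteq> opposite X"
    using assms(1,5) sg_opposite[OF circuit_disjoint, of X g] by auto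
  have "\<exists>Z\<in>C. fst Z \<subseteq> (fst X \<union> fst Y) - {e} \<and> snd Z \<subseteq> (snd X \<union> snd Y) - {e}"
  proof (cases "sg X e = 1")
    case True
    then have "e \<in> fst X \<inter> snd Y"
      using assms(3) by (auto simp: sg_def split: if_splits)
    then show ?thesis
      using weak[OF assms(1,2) X] by blast
  next
    case False
    then have "e \<in> fst Y \<inter> snd X"
      using assms(3,4) by (auto simp: sg_def split: if_splits)
    then show ?thesis
      using weak[OF assms(2,1) Y] by (simp add: Un_commute)
  qed
  then obtain Z where Z: "Z \<in> C" "fst Z \<subseteq> (fst X \<union> fst Y) - {e}" "snd Z \<subseteq> (snd X \<union> snd Y) - {e}"
    by blast
  have "sg Z f = 0 \<or> sg Z f = sg X f \<or> sg Z f = sg Y f" for f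
    using Z(2,3) circuit_disjoint[OF assms(1)] circuit_disjoint[OF assms(2)]
    by (auto simp: sg_def)
  moreover have "sg Z e = 0"
    using Z(2,3) by (auto simp: sg_def)
  ultimately show thesis
    using that Z(1) by blast
qed

lemma circuit_sign_unique:
  assumes "X \<in> C" "Y \<in> C" "support X \<subseteq> support Y"
  shows "(\<forall>f. sg X f = sg Y f) \<or> (\<forall>f. sg X f = - sg Y f)"
  using circuit_incomparable[OF assms] sg_opposite[OF circuit_disjoint[OF assms(2)]] by blast

lemma circuit_with_sign:
  assumes "X \<in> C" "e \<in> support X" "s = 1 \<or> s = - 1"
  obtains Y where "Y \<in> C" "support Y = support X" "sg Y e = s"
proof (cases "sg X e = s")
  case True
  then show ?thesis using that assms by blast
next
  case False
  have "sg (opposite X) e = s"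
    using False assms sg_cases[of X e] sg_eq_0_iff[of X e] sg_opposite[OF circuit_disjoint[OF assms(1)]]
    by auto
  then show ?thesis
    using that[of "opposite X"] assms(1) circuit_opposite by simp
qed

text \<open>\<open>Y\<close> is first given the sign at \<open>e\<close> opposite to that of
  \<open>X\<close>. An element of exactly one of the supports then has sign zero in one circuit
  only, so it can serve as \<open>g\<close> in \<open>circuit_elimination\<close>.\<close>

lemma unsigned_elimination:
  assumes "X \<in> C" "Y \<in> C" "support X \<noteq> support Y" "e \<in> support X" "e \<in> support Y"
  obtains Z where "Z \<in> C" "support Z \<subseteq> (support X \<union> support Y) - {e}"
proof -
  have s: "- sg X e = 1 \<or> - sg X e = - 1"
    using assms(4) sg_cases[of X e] sg_eq_0_iff[of X e] by auto
  obtain Y' where Y': "Y' \<in> C" "support Y' = support Y" "sg Y' e = - sg X e"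
    by (rule circuit_with_sign[OF assms(2,5) s])
  obtain g where g: "\<not> (g \<in> support X \<longleftrightarrow> g \<in> support Y)"
    using assms(3) by blast
  then have "sg X g = 0 \<longleftrightarrow> sg Y' g \<noteq> 0"
    using Y'(2) by (simp add: sg_eq_0_iff)
  then have "sg X g \<noteq> - sg Y' g" by linarith
  moreover have "sg X e = - sg Y' e" "sg X e \<noteq> 0"
    using Y'(3) s by auto
  ultimately obtain Z where Z: "Z \<in> C" "sg Z e = 0"
    "\<And>f. sg Z f = 0 \<or> sg Z f = sg X f \<or> sg Z f = sg Y' f"
    using circuit_elimination[OF assms(1) Y'(1), of e g] by blast
  have "support Z \<subseteq> (support X \<union> support Y) - {e}"
  proof
    fix f assume "f \<in> support Z"
    then have "sg Z f \<noteq> 0" by (simp add: sg_eq_0_iff)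
    then have "f \<noteq> e" "sg X f \<noteq> 0 \<or> sg Y' f \<noteq> 0"
      using Z(2) Z(3)[of f] by metis+
    then show "f \<in> (support X \<union> support Y) - {e}"
      using Y'(2) by (auto simp: sg_eq_0_iff)
  qed
  then show thesis using that Z(1) by blast
qed

section \<open>Independent sets, augmentation and rank\<close>

lemma indepD: "\<lbrakk>indep M I; X \<in> C; support X \<subseteq> I\<rbrakk> \<Longrightarrow> False"
  by (simp add: indep_def)

lemma indep_subset: "\<lbrakk>indep M J; I \<subseteq> J\<rbrakk> \<Longrightarrow> indep M I"
  unfolding indep_def by blast

lemma indep_finite: "indep M I \<Longrightarrow> finite I"
  using finite_subset[OF _ finite_E] by (auto simp: indep_def)

lemma indep_empty: "indep M {}"
  using circuit_nonempty by (auto simp: indep_def)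

lemma dependent_insert:
  assumes "indep M I" "a \<in> E" "\<not> indep M (insert a I)"
  obtains X where "X \<in> C" "a \<in> support X" "support X \<subseteq> insert a I"
  using assms unfolding indep_def by blast

text \<open>Both circuits contain \<open>e\<close>, as \<open>I\<close> is independent; if they
  differed, eliminating \<open>e\<close> would leave a circuit inside \<open>I\<close>.\<close>

lemma fundamental_circuit_unique:
  assumes "indep M I" "X \<in> C" "Y \<in> C" "support X \<subseteq> insert e I" "support Y \<subseteq> insert e I"
  shows "support X = support Y"
proof (rule ccontr)
  assume ne: "support X \<noteq> support Y"
  have "e \<in> support X" "e \<in> support Y"
    using assms indepD by blast+
  then obtain Z where Z: "Z \<in> C" "support Z \<subseteq> (support X \<union> support Y) - {e}"
    using unsigned_elimination[OF assms(2,3) ne] by blast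
  then have "support Z \<subseteq> I" using assms(4,5) by blast
  then show False
    using assms(1) Z(1) indepD by blast
qed

text \<open>Among the independent subsets of \<open>I \<union> J\<close> larger than
  \<open>I\<close>, take \<open>K\<close> with \<open>I - K\<close> smallest. If
  \<open>I \<subseteq> K\<close>, an element of \<open>K - I\<close> augments \<open>I\<close>.
  Otherwise take \<open>e\<close> in \<open>I - K\<close>: by minimality, exchanging any
  \<open>f\<close> in \<open>K - I\<close> for \<open>e\<close> creates a circuit. All these
  circuits are the fundamental circuit of \<open>e\<close> over \<open>K\<close>, so it avoids
  \<open>K - I\<close> and lies in \<open>I\<close>.\<close>

lemma augmentation:
  assumes I: "indep M I" and J: "indep M J" and "card I < card J"
  obtains j where "j \<in> J - I" "indep M (insert j I)"
proof -
  have "\<exists>j\<in>J - I. indep M (insert j I)"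
  proof (rule ccontr)
    assume no: "\<not> (\<exists>j\<in>J - I. indep M (insert j I))"
    define P where "P K \<longleftrightarrow> K \<subseteq> I \<union> J \<and> indep M K \<and> card I < card K" for K
    have "P J" using assms by (auto simp: P_def)
    then obtain K where K: "P K" "\<And>L. P L \<Longrightarrow> card (I - K) \<le> card (I - L)"
      using ex_has_least_nat[of P J "\<lambda>K. card (I - K)"] by blast
    have Ki: "indep M K" "K \<subseteq> I \<union> J" "card I < card K"
      using K(1) by (auto simp: P_def)
    have "\<not> I \<subseteq> K"
    proof
      assume "I \<subseteq> K"
      moreover have "I \<noteq> K" using Ki by auto
      ultimately obtain j where j: "j \<in> K - I" by blast
      then have "indep M (insert j I)"
        using indep_subset[OF Ki(1)] \<open>I \<subseteq> K\<close> by blast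
      then show False using no j Ki by blast
    qed
    then obtain e where e: "e \<in> I" "e \<notin> K" by blast
    have eE: "e \<in> E" using e I by (auto simp: indep_def)
    have swap: "\<not> indep M (insert e K - {f})" if f: "f \<in> K - I" for f
    proof
      assume ind: "indep M (insert e K - {f})"
      have "card (insert e K - {f}) = card K"
        using f e indep_finite[OF Ki(1)] by auto
      then have "P (insert e K - {f})"
        using Ki e ind by (auto simp: P_def)
      then have "card (I - K) \<le> card (I - (insert e K - {f}))"
        by (rule K(2))
      moreover have "I - (insert e K - {f}) = (I - K) - {e}"
        using f by auto
      moreover have "card ((I - K) - {e}) < card (I - K)"
        using e indep_finite[OF I] by (intro card_Diff1_less) auto
      ultimately show False by simp
    qed
    have "card (K - I) > 0"
    proof -
      have "\<not> K \<subseteq> I" using Ki(3) card_mono[OF indep_finite[OF I], of K] by linarith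
      then show ?thesis using indep_finite[OF Ki(1)] by (auto simp: card_gt_0_iff)
    qed
    then obtain g where g: "g \<in> K - I" by (auto simp: card_gt_0_iff)
    have circ: "\<exists>X\<in>C. support X \<subseteq> insert e K - {f}" if "f \<in> K - I" for f
      using swap[OF that] eE Ki(1) unfolding indep_def by blast
    obtain X where X: "X \<in> C" "support X \<subseteq> insert e K - {g}"
      using circ[OF g] by blast
    have "f \<notin> support X" if f: "f \<in> K - I" for f
    proof -
      obtain Y where Y: "Y \<in> C" "support Y \<subseteq> insert e K - {f}"
        using circ[OF f] by blast
      then have "support X = support Y"
        using X by (intro fundamental_circuit_unique[OF Ki(1)]) auto
      then show ?thesis using Y by auto
    qed
    then have "support X \<subseteq> I" using X e by blast
    then show False using X I indepD by blast
  qed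
  then show thesis using that by blast
qed

lemma max_indep_extend:
  assumes "indep M I" "I \<subseteq> A" "A \<subseteq> E"
  obtains J where "I \<subseteq> J" "max_indep_in A J"
proof -
  have fin: "finite A" using assms(3) finite_subset by blast
  define P where "P J \<longleftrightarrow> I \<subseteq> J \<and> J \<subseteq> A \<and> indep M J" for J
  have "P I" using assms by (auto simp: P_def)
  moreover have "\<forall>J. P J \<longrightarrow> card J < Suc (card A)"
    using fin by (auto simp: P_def card_mono less_Suc_eq_le)
  ultimately have "\<exists>J. P J \<and> (\<forall>L. P L \<longrightarrow> card L \<le> card J)"
    using ex_has_greatest_nat[of P I card "Suc (card A)"] by simp
  then obtain J where J: "P J" "\<And>L. P L \<Longrightarrow> card L \<le> card J" by blast
  have "max_indep_in A J"
    unfolding max_indep_in_def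
  proof (intro conjI ballI notI)
    fix a assume a: "a \<in> A - J" "indep M (insert a J)"
    then have "P (insert a J)" using J(1) by (auto simp: P_def)
    then have "card (insert a J) \<le> card J" by (rule J(2))
    then show False using a indep_finite[OF a(2)] by simp
  qed (use J(1) in \<open>auto simp: P_def\<close>)
  then show thesis using that J(1) by (auto simp: P_def)
qed

lemma max_indep_card_le:
  assumes "max_indep_in A I" "indep M J" "J \<subseteq> A"
  shows "card J \<le> card I"
proof (rule ccontr)
  assume "\<not> card J \<le> card I"
  then obtain j where "j \<in> J - I" "indep M (insert j I)"
    using augmentation[of I J] assms by (auto simp: max_indep_in_def)
  then show False using assms by (auto simp: max_indep_in_def)
qed

lemma rank_eq:
  assumes "max_indep_in A I"
  shows "rank M A = card I"
  unfolding rank_def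
proof (rule Max_eqI)
  have "finite {I. I \<subseteq> A \<and> indep M I}"
    by (rule finite_subset[of _ "Pow E"]) (auto simp: indep_def)
  then show "finite (card ` {I. I \<subseteq> A \<and> indep M I})"
    by (rule finite_imageI)
next
  fix n assume "n \<in> card ` {I. I \<subseteq> A \<and> indep M I}"
  then show "n \<le> card I" using max_indep_card_le[OF assms] by blast
next
  show "card I \<in> card ` {I. I \<subseteq> A \<and> indep M I}"
    using assms unfolding max_indep_in_def by blast
qed

lemma max_indepI:
  assumes "I \<subseteq> A" "indep M I" "A \<subseteq> E" "card I = rank M A"
  shows "max_indep_in A I"
proof -
  obtain J where J: "I \<subseteq> J" "max_indep_in A J"
    by (rule max_indep_extend[OF assms(2,1,3)])
  then have "card I = card J" "finite J"
    using rank_eq[OF J(2)] assms(4) indep_finite[of J] by (simp_all add: max_indep_in_def)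
  then have "I = J"
    using J(1) by (intro card_subset_eq)
  then show ?thesis using J by simp
qed

text \<open>By minimality of circuits, \<open>support X - {a}\<close> is independent and extends to
  a maximal \<open>J\<close> in \<open>A\<close>, and \<open>insert a J\<close> is dependent. If
  \<open>insert a I\<close> were independent, it would be larger than \<open>J\<close> and would
  augment it by \<open>a\<close> or by an element of \<open>A\<close>, both impossible.\<close>

lemma spans_max_indep_iff:
  assumes I: "max_indep_in A I" and "A \<subseteq> E" "a \<in> E - A"
  shows "spans C A a \<longleftrightarrow> \<not> indep M (insert a I)"
proof
  assume "spans C A a"
  then obtain X where X: "X \<in> C" "a \<in> support X" "support X \<subseteq> insert a A"
    by (auto simp: spans_def)
  have "indep M (support X - {a})"
    unfolding indep_def
  proof (intro conjI ballI notI)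
    fix Y assume Y: "Y \<in> C" "support Y \<subseteq> support X - {a}"
    then have "Y = X \<or> Y = opposite X" by (intro circuit_incomparable X(1)) auto
    then have "support Y = support X" by auto
    then show False using X(2) Y(2) by auto
  qed (use circuit_support[OF X(1)] in auto)
  moreover have "support X - {a} \<subseteq> A" using X by auto
  ultimately obtain J where J: "support X - {a} \<subseteq> J" "max_indep_in A J"
    using max_indep_extend assms(2) by blast
  show "\<not> indep M (insert a I)"
  proof
    assume ind: "indep M (insert a I)"
    have "card (insert a I) = Suc (card J)"
      using assms(3) indep_finite[of I] rank_eq[OF I] rank_eq[OF J(2)] I
      by (subst card_insert_disjoint) (auto simp: max_indep_in_def)
    then obtain j where "j \<in> insert a I - J" "indep M (insert j J)"
      using augmentation[OF _ ind, of J] J(2) unfolding max_indep_in_def by auto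
    moreover have "\<not> indep M (insert a J)"
      using X J indepD[of "insert a J" X] by blast
    ultimately show False using I J(2) by (auto simp: max_indep_in_def)
  qed
next
  assume "\<not> indep M (insert a I)"
  then obtain X where "X \<in> C" "a \<in> support X" "support X \<subseteq> insert a I"
    using dependent_insert[of I a] I assms by (auto simp: max_indep_in_def)
  then show "spans C A a"
    using I by (auto simp: spans_def max_indep_in_def)
qed

text \<open>Together with \<open>rank_empty\<close> this determines the rank from
  \<open>spans\<close> alone, the form in which it enters the deletion-contraction
  recursion.\<close>

lemma rank_insert:
  assumes "A \<subseteq> E" "a \<in> E - A"
  shows "rank M (insert a A) = rank M A + (if spans C A a then 0 else 1)"
proof -
  obtain I where I: "max_indep_in A I"
    using max_indep_extend[OF indep_empty _ assms(1)] by auto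
  note iff = spans_max_indep_iff[OF I assms]
  show ?thesis
  proof (cases "spans C A a")
    case True
    then have "max_indep_in (insert a A) I"
      using I iff by (auto simp: max_indep_in_def)
    then show ?thesis using True rank_eq I by simp
  next
    case False
    have "\<not> indep M (insert b (insert a I))" if "b \<in> A - I" for b
      using that I indep_subset[of "insert b (insert a I)" "insert b I"]
      by (auto simp: max_indep_in_def)
    then have "max_indep_in (insert a A) (insert a I)"
      using False I iff by (auto simp: max_indep_in_def)
    moreover have "a \<notin> I" using I assms by (auto simp: max_indep_in_def)
    moreover have "finite I" using I indep_finite by (auto simp: max_indep_in_def)
    ultimately show ?thesis using False rank_eq I by simp
  qed
qed

lemma rank_empty: "rank M {} = 0"
proof -
  have "max_indep_in {} {}" using indep_empty by (simp add: max_indep_in_def)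
  then show ?thesis using rank_eq by simp
qed

lemma basis_iff_max_indep: "basis M B \<longleftrightarrow> max_indep_in E B"
proof
  assume B: "basis M B"
  show "max_indep_in E B"
    unfolding max_indep_in_def
  proof (intro conjI ballI notI)
    fix a assume "a \<in> E - B" "indep M (insert a B)"
    then show False using B by (auto simp: basis_def)
  qed (use B in \<open>auto simp: basis_def indep_def\<close>)
next
  assume B: "max_indep_in E B"
  show "basis M B"
    unfolding basis_def
  proof (intro conjI allI impI)
    fix I assume I: "indep M I \<and> B \<subseteq> I"
    show "I = B"
    proof (rule ccontr)
      assume "I \<noteq> B"
      then obtain a where a: "a \<in> I - B" using I by blast
      then have "indep M (insert a B)" using I indep_subset[of I "insert a B"] by auto
      moreover have "a \<in> E - B" using a I by (auto simp: indep_def)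
      ultimately show False using B by (auto simp: max_indep_in_def)
    qed
  qed (use B in \<open>auto simp: max_indep_in_def\<close>)
qed

subsection \<open>Signatures of complements of hyperplanes\<close>

text \<open>A basis of \<open>R\<close> together with \<open>e\<close> extends to a basis
  \<open>B\<close> of the matroid; \<open>H\<close> is the closure of
  \<open>B - {e}\<close>.\<close>

lemma hyperplane_exists:
  assumes "R \<subseteq> E" "e \<in> E - R" "\<not> spans C R e"
  obtains H where "hyperplane H" "R \<subseteq> H" "e \<notin> H"
proof -
  obtain I where I: "max_indep_in R I"
    using max_indep_extend[OF indep_empty _ assms(1)] by auto
  have "indep M (insert e I)"
    using spans_max_indep_iff[OF I assms(1,2)] assms(3) by simp
  moreover have "insert e I \<subseteq> E" using I assms by (auto simp: max_indep_in_def)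
  ultimately obtain B where B: "insert e I \<subseteq> B" "max_indep_in E B"
    using max_indep_extend by blast
  define B0 where "B0 = B - {e}"
  define H where "H = {h \<in> E. h \<in> B0 \<or> \<not> indep M (insert h B0)}"
  have Bi: "indep M B" "B \<subseteq> E" and Ii: "I \<subseteq> R" "\<And>r. r \<in> R - I \<Longrightarrow> \<not> indep M (insert r I)"
    using B(2) I unfolding max_indep_in_def by blast+
  have B0: "indep M B0" "B0 \<subseteq> E" "I \<subseteq> B0"
    using Bi B(1) Ii(1) assms(2) indep_subset[of B B0] unfolding B0_def by blast+
  have H: "max_indep_in H B0" "H \<subseteq> E"
    using B0 unfolding H_def max_indep_in_def by blast+
  have "insert e B0 = B" using B by (auto simp: B0_def)
  then have "e \<notin> H" using Bi by (simp add: H_def B0_def)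
  moreover have "R \<subseteq> H"
  proof
    fix r assume r: "r \<in> R"
    then have "r \<in> I \<or> \<not> indep M (insert r I)" using Ii(2) by blast
    moreover have "insert r I \<subseteq> insert r B0" using B0(3) by blast
    ultimately show "r \<in> H"
      using r B0(3) assms(1) indep_subset[of "insert r B0" "insert r I"] unfolding H_def by blast
  qed
  moreover have "hyperplane H"
    unfolding hyperplane_def
  proof (intro conjI ballI)
    fix d assume d: "d \<in> E - H"
    then show "\<not> spans C H d"
      using spans_max_indep_iff[OF H d] unfolding H_def by blast
  next
    have "card B = Suc (card B0)"
      using B(1) indep_finite[OF Bi(1)] card_Suc_Diff1[of B e] by (simp add: B0_def)
    then show "Suc (rank M H) = rank M E"
      using rank_eq[OF H(1)] rank_eq[OF B(2)] by simp
  qed (rule H(2))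
  ultimately show thesis using that by blast
qed

section \<open>Circuits leaving a hyperplane in two elements, and the cocircuits they sign\<close>

context
  fixes H assumes H: "hyperplane H"
begin

lemma hyperplane_subset: "H \<subseteq> E"
  using H by (simp add: hyperplane_def)

lemma hyperplane_insert_indep:
  "\<lbrakk>max_indep_in H B; d \<in> E - H\<rbrakk> \<Longrightarrow> indep M (insert d B)"
  using spans_max_indep_iff[OF _ hyperplane_subset] H by (auto simp: hyperplane_def)

lemma hyperplane_insert_basis:
  assumes "max_indep_in H B" "d \<in> E - H"
  shows "max_indep_in E (insert d B)"
proof (rule max_indepI)
  have "d \<notin> B" "finite B" "B \<subseteq> E"
    using assms hyperplane_subset indep_finite by (auto simp: max_indep_in_def)
  then show "insert d B \<subseteq> E" "card (insert d B) = rank M E"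
    using assms H rank_eq[OF assms(1)] by (auto simp: hyperplane_def)
qed (use hyperplane_insert_indep[OF assms] in auto)

lemma circuit_in_hyperplane:
  assumes "X \<in> C" "support X \<subseteq> insert d H" "d \<in> E - H"
  shows "support X \<subseteq> H"
  using assms H unfolding hyperplane_def spans_def by blast

lemma pair_circuit_mem:
  assumes "max_indep_in H B" "d \<in> E - H" "d' \<in> E - H"
    and "X \<in> C" "support X \<subseteq> insert d (insert d' B)"
  shows "d \<in> support X"
  using indepD[OF hyperplane_insert_indep[OF assms(1,3)] assms(4)] assms(5) by blast

lemma pair_circuit_exists:
  assumes "max_indep_in H B" "d \<in> E - H" "d' \<in> E - H" "d \<noteq> d'" "s = 1 \<or> s = - 1"
  obtains X where "X \<in> C" "support X \<subseteq> insert d (insert d' B)" "sg X d = s"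
proof -
  have B: "B \<subseteq> H" using assms by (auto simp: max_indep_in_def)
  have "\<not> indep M (insert d (insert d' B))"
    using hyperplane_insert_basis[OF assms(1,3)] assms(2,4) B by (auto simp: max_indep_in_def)
  then obtain X where X: "X \<in> C" "d \<in> support X" "support X \<subseteq> insert d (insert d' B)"
    using dependent_insert[of "insert d' B" d] hyperplane_insert_indep[OF assms(1,3)] assms(2)
    by blast
  then obtain Y where "Y \<in> C" "support Y = support X" "sg Y d = s"
    using circuit_with_sign[OF X(1,2) assms(5)] by blast
  then show thesis using that X by simp
qed

lemma pair_circuit_sign_unique:
  assumes "max_indep_in H B" "d \<in> E - H" "d' \<in> E - H"
    and "X \<in> C" "support X \<subseteq> insert d (insert d' B)"
    and "Y \<in> C" "support Y \<subseteq> insert d (insert d' B)"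
  shows "sg X d * sg X d' = sg Y d * sg Y d'"
proof -
  have "support X = support Y"
    using hyperplane_insert_indep[OF assms(1,3)] assms(4-) by (intro fundamental_circuit_unique)
  then show ?thesis
    using circuit_sign_unique[OF assms(4,6)] by auto
qed

text \<open>
  If the two signs differed, eliminating \<open>d'\<close> from \<open>X\<close> and \<open>Y\<close> and eliminating \<open>d\<close> from
  \<open>X\<close> and \<open>- Y\<close> would give two circuits inside \<open>insert c B\<close> whose signs agree at \<open>b\<close> and
  disagree at \<open>c\<close>.
\<close>

lemma pair_circuit_sign_exchange:
  assumes B: "max_indep_in H B" and B': "max_indep_in H (insert c (B - {b}))"
    and b: "b \<in> B" and c: "c \<notin> B"
    and d: "d \<in> E - H" "d' \<in> E - H" "d \<noteq> d'"
    and X: "X \<in> C" "support X \<subseteq> insert d (insert d' B)"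
    and Y: "Y \<in> C" "support Y \<subseteq> insert d (insert d' (insert c (B - {b})))"
  shows "sg X d * sg X d' = sg Y d * sg Y d'"
proof (rule ccontr)
  assume ne: "sg X d * sg X d' \<noteq> sg Y d * sg Y d'"
  have sub: "B \<subseteq> H" "c \<in> H" "b \<in> H" "b \<noteq> c" using B B' b c by (auto simp: max_indep_in_def)
  have Xd: "sg X d \<noteq> 0" "sg X d' \<noteq> 0" and Yd: "sg Y d \<noteq> 0" "sg Y d' \<noteq> 0"
    using pair_circuit_mem[OF B d(1,2) X] pair_circuit_mem[OF B' d(1,2) Y]
      pair_circuit_mem[OF B d(2,1) X(1)] pair_circuit_mem[OF B' d(2,1) Y(1)] X(2) Y(2)
    by (auto simp: sg_eq_0_iff insert_commute)
  obtain s where s: "s = 1 \<or> s = - 1" "sg X d' = - s" using sg_cases[of X d'] Xd by force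
  have "d' \<in> support Y" using Yd by (simp add: sg_eq_0_iff)
  \<comment> \<open>\<open>W\<close> is \<open>Y\<close> up to a global sign, chosen so that
    \<open>d'\<close> can be eliminated between \<open>X\<close> and \<open>W\<close>. The assumed
    inequality then makes \<open>X\<close> and \<open>W\<close> agree at \<open>d\<close>, so that
    \<open>d\<close> can be eliminated between \<open>X\<close> and the opposite of
    \<open>W\<close>.\<close>
  then obtain W where W: "W \<in> C" "support W = support Y" "sg W d' = s"
    using circuit_with_sign[OF Y(1) _ s(1)] by metis
  have "sg W d * sg W d' = sg Y d * sg Y d'"
    using circuit_sign_unique[OF W(1) Y(1)] W(2) by (metis minus_mult_minus order_refl)
  then have "sg X d \<noteq> - sg W d"
    using ne s(2) W(3) by auto
  moreover have "sg W d \<noteq> 0"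
    using Yd(1) W(2) by (simp add: sg_eq_0_iff)
  ultimately have Wd: "sg W d = sg X d"
    using Xd(1) sg_cases[of X d] sg_cases[of W d] by linarith
  have op: "sg (opposite W) f = - sg W f" for f
    using sg_opposite[OF circuit_disjoint[OF W(1)]] .
  have XW: "b \<notin> support W" "c \<notin> support X" using W(2) X(2) Y(2) d sub c by auto
  \<comment> \<open>Losing one of \<open>d\<close>, \<open>d'\<close> means losing both, because no
    circuit leaves \<open>H\<close> in a single element. The rest lies in \<open>insert c B\<close>,
    and independence of the two bases forces \<open>c\<close> and \<open>b\<close> into the
    circuit.\<close>
  have in_cB: "support Z \<subseteq> insert c B \<and> b \<in> support Z \<and> c \<in> support Z"
    if "Z \<in> C" "sg Z d = 0 \<or> sg Z d' = 0"
      "\<And>f. sg Z f = 0 \<or> sg Z f = sg X f \<or> sg Z f = sg W f \<or> sg Z f = - sg W f" for Z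
  proof -
    have "support Z \<subseteq> support X \<union> support W"
      using that(3) unfolding subset_iff Un_iff by (metis sg_eq_0_iff neg_0_equal_iff_equal)
    then have 1: "support Z \<subseteq> insert d (insert d' (insert c B))"
      using X(2) Y(2) W(2) by blast
    have "support Z \<subseteq> insert d H \<or> support Z \<subseteq> insert d' H"
      using 1 that(2) sub by (auto simp: sg_eq_0_iff)
    then have "support Z \<subseteq> H"
      using circuit_in_hyperplane[OF that(1)] d by blast
    then have 2: "support Z \<subseteq> insert c B" using 1 d by blast
    then have "c \<in> support Z" using B that(1) indepD[of B Z] unfolding max_indep_in_def by blast
    moreover have "b \<in> support Z"
      using B' that(1) 2 indepD[of "insert c (B - {b})" Z] unfolding max_indep_in_def by blast
    ultimately show ?thesis using 2 by blast
  qed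
  have el: "sg X d' = - sg W d'" "sg X d \<noteq> - sg W d"
    "sg X d = - sg (opposite W) d" "sg X d' \<noteq> - sg (opposite W) d'"
    using s W(3) Wd Xd op by auto
  obtain Z where Z: "Z \<in> C" "sg Z d' = 0" "\<And>f. sg Z f = 0 \<or> sg Z f = sg X f \<or> sg Z f = sg W f"
    using circuit_elimination[OF X(1) W(1) el(1) Xd(2) el(2)] by blast
  obtain Z' where Z': "Z' \<in> C" "sg Z' d = 0"
    "\<And>f. sg Z' f = 0 \<or> sg Z' f = sg X f \<or> sg Z' f = - sg W f"
    using circuit_elimination[OF X(1) circuit_opposite[OF W(1)] el(3) Xd(1) el(4), unfolded op] by blast
  have m: "support Z \<subseteq> insert c B" "b \<in> support Z" "c \<in> support Z"
    "support Z' \<subseteq> insert c B" "b \<in> support Z'" "c \<in> support Z'"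
    using in_cB[OF Z(1)] in_cB[OF Z'(1)] Z Z' by blast+
  have "support Z = support Z'"
    using B m by (intro fundamental_circuit_unique[OF _ Z(1) Z'(1), of B c]) (auto simp: max_indep_in_def)
  then have "(\<forall>f. sg Z f = sg Z' f) \<or> (\<forall>f. sg Z f = - sg Z' f)"
    using circuit_sign_unique[OF Z(1) Z'(1)] by simp
  moreover have nz: "sg Z b \<noteq> 0" "sg Z c \<noteq> 0" "sg Z' b \<noteq> 0" "sg Z' c \<noteq> 0"
    and z: "sg W b = 0" "sg X c = 0"
    using m XW by (simp_all add: sg_eq_0_iff)
  \<comment> \<open>Only \<open>X\<close> can supply the sign at \<open>b\<close>, and only
    \<open>W\<close> or its opposite the sign at \<open>c\<close>.\<close>
  moreover have "sg Z b = sg X b" "sg Z' b = sg X b" "sg Z c = sg W c" "sg Z' c = - sg W c"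
    using Z(3)[of b] Z'(3)[of b] Z(3)[of c] Z'(3)[of c] nz z by linarith+
  ultimately show False
    by (metis neg_equal_zero)
qed

text \<open>Basis exchange moves \<open>B\<close> towards \<open>B'\<close> one element at a time,
  and \<open>pair_circuit_sign_exchange\<close> shows that each move preserves the product of
  signs.\<close>

lemma pair_circuit_sign_indep_of_basis:
  assumes "max_indep_in H B" "max_indep_in H B'"
    and d: "d \<in> E - H" "d' \<in> E - H" "d \<noteq> d'"
    and "X \<in> C" "support X \<subseteq> insert d (insert d' B)"
    and "Y \<in> C" "support Y \<subseteq> insert d (insert d' B')"
  shows "sg X d * sg X d' = sg Y d * sg Y d'"
  using assms(1,6,7)
proof (induction "card (B' - B)" arbitrary: B X rule: less_induct)
  case less
  note B = less.prems(1)
  have fin: "finite B" "finite B'"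
    using B assms(2) indep_finite by (auto simp: max_indep_in_def)
  have card: "card B = card B'" using rank_eq[OF B] rank_eq[OF assms(2)] by simp
  show ?case
  proof (cases "B = B'")
    case True
    then show ?thesis
      using pair_circuit_sign_unique[OF B d(1,2) less.prems(2,3) assms(8)] assms(9) by blast
  next
    case False
    then have "\<not> B \<subseteq> B'" using card_subset_eq[OF fin(2)] card by blast
    then obtain b where b: "b \<in> B" "b \<notin> B'" by blast
    have "card (B - {b}) < card B'"
      using b fin card card_Diff1_less[of B b] by simp
    have "indep M (B - {b})" "indep M B'"
      using B assms(2) indep_subset[of B "B - {b}"] unfolding max_indep_in_def by blast+
    then obtain c where c: "c \<in> B' - (B - {b})" "indep M (insert c (B - {b}))"
      by (rule augmentation[OF _ _ \<open>card (B - {b}) < card B'\<close>])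
    then have cB: "c \<in> B'" "c \<notin> B" using b by auto
    let ?B = "insert c (B - {b})"
    have "max_indep_in H ?B"
    proof (rule max_indepI)
      show "?B \<subseteq> H" using B assms(2) cB by (auto simp: max_indep_in_def)
      show "card ?B = rank M H"
        using rank_eq[OF B] fin cB b card_Suc_Diff1[of B b] by simp
    qed (use c hyperplane_subset in auto)
    moreover have "card (B' - ?B) < card (B' - B)"
      using cB b fin by (intro psubset_card_mono) auto
    moreover obtain W where W: "W \<in> C" "support W \<subseteq> insert d (insert d' ?B)"
      using pair_circuit_exists[OF \<open>max_indep_in H ?B\<close> d, of 1] by blast
    ultimately have "sg W d * sg W d' = sg Y d * sg Y d'"
      using less.hyps by blast
    with pair_circuit_sign_exchange[OF B \<open>max_indep_in H ?B\<close> b(1) cB(2) d less.prems(2,3) W]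
    show ?thesis
      by (rule trans)
  qed
qed

text \<open>The sign at the reference element \<open>e\<close> is normalised to 1. The circuits
  through \<open>e\<close> and \<open>d\<close> then force the sign at \<open>d\<close>, and
  elimination of \<open>e\<close> yields the condition for pairs avoiding \<open>e\<close>.\<close>

lemma hyperplane_signature:
  assumes e: "e \<in> E - H"
  obtains y where "signature H y"
proof -
  define good where "good d s \<longleftrightarrow> (s = 1 \<or> s = (- 1 :: int)) \<and> (\<forall>B X. max_indep_in H B \<longrightarrow>
     X \<in> C \<longrightarrow> support X \<subseteq> insert e (insert d B) \<longrightarrow> sg X e * sg X d = - s)" for d s
  have "\<exists>s. good d s" if d: "d \<in> E - H" "d \<noteq> e" for d
  proof -
    obtain B where B: "max_indep_in H B"
      using max_indep_extend[OF indep_empty _ hyperplane_subset] by auto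
    obtain X where X: "X \<in> C" "support X \<subseteq> insert e (insert d B)" "sg X e = 1"
      using pair_circuit_exists[OF B e d(1), of 1] d by blast
    have "d \<in> support X"
      using pair_circuit_mem[OF B d(1) e X(1)] X(2) by (simp add: insert_commute)
    then have "good d (- sg X d)"
      unfolding good_def
      using sg_cases[of X d] sg_eq_0_iff[of X d] X(3) d(2)
        pair_circuit_sign_indep_of_basis[OF _ B e d(1) _ _ _ X(1,2)] by force
    then show ?thesis by blast
  qed
  then obtain y0 where y0: "\<And>d. \<lbrakk>d \<in> E - H; d \<noteq> e\<rbrakk> \<Longrightarrow> good d (y0 d)" by metis
  \<comment> \<open>The default value 1 also provides the normalisation at \<open>e\<close>.\<close>
  define y where "y d = (if d \<in> E - H \<and> d \<noteq> e then y0 d else 1)" for d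
  have y: "y d = 1 \<or> y d = - 1" for d
    using y0[of d] by (auto simp: y_def good_def)
  have base: "sg X e * sg X d = - y d"
    if "max_indep_in H B" "d \<in> E - H" "d \<noteq> e" "X \<in> C" "support X \<subseteq> insert e (insert d B)" for B d X
  proof -
    have "good d (y0 d)" "y d = y0 d" using y0 that by (simp_all add: y_def)
    then show ?thesis using that unfolding good_def by metis
  qed
  have ye: "y e = 1" by (simp add: y_def)
  have "sg X d * sg X d' = - (y d * y d')"
    if B: "max_indep_in H B" and d: "d \<in> E - H" "d' \<in> E - H" "d \<noteq> d'"
      and X: "X \<in> C" "support X \<subseteq> insert d (insert d' B)" for B d d' X
  proof -
    consider "d = e" | "d' = e" | "d \<noteq> e" "d' \<noteq> e" by blast
    then show ?thesis
    proof cases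
      case 1
      then show ?thesis using base[OF B d(2) _ X(1)] X(2) d ye by auto
    next
      case 2
      then show ?thesis using base[OF B d(1) _ X(1)] X(2) d ye by (auto simp: insert_commute mult.commute)
    next
      case 3
      \<comment> \<open>\<open>U\<close> and \<open>V\<close> have opposite signs at
        \<open>e\<close>. Eliminating \<open>e\<close> gives a circuit for the pair
        \<open>d\<close>, \<open>d'\<close> whose sign at \<open>d\<close> comes from
        \<open>U\<close> and at \<open>d'\<close> from \<open>V\<close>.\<close>
      obtain U where U: "U \<in> C" "support U \<subseteq> insert e (insert d B)" "sg U e = 1"
        using pair_circuit_exists[OF B e d(1), of 1] 3 by blast
      obtain V where V: "V \<in> C" "support V \<subseteq> insert e (insert d' B)" "sg V e = - 1"
        using pair_circuit_exists[OF B e d(2), of "- 1"] 3 by blast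
      have Ud: "sg U d = - y d" using base[OF B d(1) 3(1) U(1,2)] U(3) by simp
      have Vd: "sg V d' = y d'" using base[OF B d(2) 3(2) V(1,2)] V(3) by simp
      have BH: "B \<subseteq> H" using B by (auto simp: max_indep_in_def)
      have "d \<notin> support V" "d' \<notin> support U" using U V 3 d BH by auto
      then have z: "sg V d = 0" "sg U d' = 0" by (simp_all add: sg_eq_0_iff)
      have el: "sg U e = - sg V e" "sg U e \<noteq> 0" "sg U d \<noteq> - sg V d"
        using U(3) V(3) z Ud y[of d] by auto
      obtain Z where Z: "Z \<in> C" "sg Z e = 0" "\<And>f. sg Z f = 0 \<or> sg Z f = sg U f \<or> sg Z f = sg V f"
        using circuit_elimination[OF U(1) V(1) el] by blast
      have "support Z \<subseteq> support U \<union> support V"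
        using Z(3) unfolding subset_iff Un_iff by (metis sg_eq_0_iff)
      moreover have "e \<notin> support Z" using Z(2) by (simp add: sg_eq_0_iff)
      ultimately have Zs: "support Z \<subseteq> insert d (insert d' B)" using U V by blast
      then have "d \<in> support Z" "d' \<in> support Z"
        using pair_circuit_mem[OF B d(1,2) Z(1)] pair_circuit_mem[OF B d(2,1) Z(1)]
        by (auto simp: insert_commute)
      then have "sg Z d \<noteq> 0" "sg Z d' \<noteq> 0" by (simp_all add: sg_eq_0_iff)
      then have "sg Z d = - y d" "sg Z d' = y d'"
        using Z(3)[of d] Z(3)[of d'] z Ud Vd by linarith+
      then show ?thesis
        using pair_circuit_sign_unique[OF B d(1,2) X Z(1) Zs] by simp
    qed
  qed
  then show thesis using that y unfolding signature_def by blast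
qed

text \<open>Suppose \<open>X\<close> agrees with \<open>y\<close> at all its elements outside
  \<open>H\<close>. A circuit \<open>W\<close> through two of these elements, \<open>d\<close> and
  \<open>d'\<close>, opposite to \<open>X\<close> at \<open>d\<close>, agrees with \<open>y\<close>
  at \<open>d'\<close>. Eliminating \<open>d\<close> gives a circuit with fewer elements outside
  \<open>H\<close>, and by induction it disagrees with \<open>y\<close> somewhere; neither
  \<open>X\<close> nor \<open>W\<close> can supply that sign.\<close>

lemma signature_orthogonal:
  assumes sgn: "signature H y" and X: "X \<in> C" "\<not> support X \<subseteq> H"
  shows "\<exists>d\<in>E - H. sg X d = - y d"
proof -
  have y: "y d = 1 \<or> y d = - 1" for d
    using sgn by (simp add: signature_def)
  have "indep M (support X \<inter> H)"
    unfolding indep_def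
  proof (intro conjI ballI notI)
    fix Y assume Y: "Y \<in> C" "support Y \<subseteq> support X \<inter> H"
    then have "support Y = support X"
      using circuit_incomparable[OF Y(1) X(1)] by auto
    then show False using X(2) Y(2) by auto
  qed (use hyperplane_subset in auto)
  then obtain B where B: "support X \<inter> H \<subseteq> B" "max_indep_in H B"
    using max_indep_extend[OF _ _ hyperplane_subset] by blast
  \<comment> \<open>This inclusion is inherited by the eliminated circuit. As \<open>B\<close> is
    independent, it also ensures that every circuit in the induction leaves
    \<open>H\<close>.\<close>
  have "support X \<subseteq> B \<union> (E - H)" using B circuit_support[OF X(1)] by auto
  then show ?thesis using X(1)
  proof (induction "card (support X - H)" arbitrary: X rule: less_induct)
    case less
    note Xs = less.prems(1)
    have fin: "finite (support X)" using finite_subset[OF circuit_support[OF less.prems(2)]] by simp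
    have BH: "B \<subseteq> H" using B by (auto simp: max_indep_in_def)
    have "\<not> support X \<subseteq> B" using B(2) less.prems(2) indepD[of B X] unfolding max_indep_in_def by blast
    then obtain d where d: "d \<in> support X" "d \<in> E - H" using Xs by blast
    have "\<not> support X \<subseteq> insert d B"
      using hyperplane_insert_indep[OF B(2) d(2)] less.prems(2) indepD by blast
    then obtain d' where d': "d' \<in> support X" "d' \<in> E - H" "d \<noteq> d'" using Xs by blast
    show ?case
    proof (rule ccontr)
      assume no: "\<not> ?case"
      have eq: "sg X f = y f" if "f \<in> support X" "f \<in> E - H" for f
        using no that sg_cases[of X f] y[of f] sg_eq_0_iff[of X f] by force
      have s: "- y d = 1 \<or> - y d = - 1" using y[of d] by auto
      obtain W where W: "W \<in> C" "support W \<subseteq> insert d (insert d' B)" "sg W d = - y d"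
        using pair_circuit_exists[OF B(2) d(2) d'(2,3) s] by blast
      have Wd': "sg W d' = y d'"
      proof -
        have "sg W d * sg W d' = - (y d * y d')"
          using sgn B(2) d(2) d'(2,3) W(1,2) unfolding signature_def by blast
        then show ?thesis using W(3) y[of d] by auto
      qed
      have el: "sg X d = - sg W d" "sg X d \<noteq> 0" "sg X d' \<noteq> - sg W d'"
        using W(3) Wd' eq[OF d] eq[OF d'(1,2)] y[of d] y[of d'] by auto
      obtain Z where Z: "Z \<in> C" "sg Z d = 0" "\<And>f. sg Z f = 0 \<or> sg Z f = sg X f \<or> sg Z f = sg W f"
        using circuit_elimination[OF less.prems(2) W(1) el] by blast
      have "support Z \<subseteq> support X \<union> support W" using Z(3) unfolding subset_iff Un_iff by (metis sg_eq_0_iff)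
      moreover have "d \<notin> support Z" using Z(2) by (simp add: sg_eq_0_iff)
      ultimately have Zs: "support Z \<subseteq> support X \<union> B - {d}" using W(2) d'(1) by blast
      have "support Z - H \<subset> support X - H" using Zs BH d by blast
      then have "card (support Z - H) < card (support X - H)"
        using fin by (intro psubset_card_mono) auto
      moreover have "support Z \<subseteq> B \<union> (E - H)" using Zs Xs by blast
      ultimately obtain f where f: "f \<in> E - H" "sg Z f = - y f"
        using less.hyps Z(1) by blast
      then have "f \<in> support Z" using y[of f] sg_eq_0_iff[of Z f] by auto
      then have fX: "f \<in> support X" "f \<noteq> d" using Zs BH f(1) by auto
      then have "sg W f = - y f"
        using Z(3)[of f] f(2) eq[OF fX(1) f(1)] y[of f] by linarith
      then have "f \<in> support W" using y[of f] sg_eq_0_iff[of W f] by auto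
      then have "f = d'" using W(2) fX f BH by auto
      then show False using Wd' \<open>sg W f = - y f\<close> y[of f] by auto
    qed
  qed
qed

text \<open>No basis fits into \<open>H\<close>, by rank. A proper subset of the complement misses
  some \<open>d\<close>, and a basis of \<open>H\<close> together with \<open>d\<close> is a basis
  avoiding that subset.\<close>

lemma hyperplane_unsigned_cocircuit: "unsigned_cocircuit M (E - H)"
  unfolding unsigned_cocircuit_def
proof (intro conjI allI impI)
  show "\<not> coindep M (E - H)"
  proof
    assume "coindep M (E - H)"
    then obtain B where B: "max_indep_in E B" "E - H \<subseteq> E - B"
      by (auto simp: coindep_def basis_iff_max_indep)
    obtain B' where B': "max_indep_in H B'"
      using max_indep_extend[OF indep_empty _ hyperplane_subset] by auto
    have "B \<subseteq> H" using B by (auto simp: max_indep_in_def)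
    then have "card B \<le> card B'"
      using max_indep_card_le[OF B'] B by (auto simp: max_indep_in_def)
    then show False
      using rank_eq[OF B'] rank_eq[OF B(1)] H by (simp add: hyperplane_def)
  qed
next
  fix D assume D: "D \<subset> E - H"
  then obtain d where d: "d \<in> E - H" "d \<notin> D" by blast
  obtain B where B: "max_indep_in H B"
    using max_indep_extend[OF indep_empty _ hyperplane_subset] by auto
  have "D \<subseteq> E - insert d B" using D d B by (auto simp: max_indep_in_def)
  then show "coindep M D"
    using hyperplane_insert_basis[OF B d(1)] unfolding coindep_def basis_iff_max_indep by blast
qed auto

text \<open>Applying \<open>signature_orthogonal\<close> to \<open>X\<close> and to its opposite
  gives one disagreement and one agreement in sign, the two halves of orthogonality.\<close>

lemma hyperplane_cocircuit:
  assumes "e \<in> E - H"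
  obtains Y where "Y \<in> cocircuits M" "support Y = E - H"
proof -
  obtain y where sgn: "signature H y"
    using hyperplane_signature[OF assms] by blast
  then have y: "y d = 1 \<or> y d = - 1" for d
    by (simp add: signature_def)
  define Y where "Y = ({d \<in> E - H. y d = 1}, {d \<in> E - H. y d = - 1})"
  have s: "support Y = E - H" using y by (auto simp: Y_def support_def)
  have "orthogonal X Y" if X: "X \<in> C" for X
  proof (cases "support X \<subseteq> H")
    case True
    then show ?thesis using s by (auto simp: orthogonal_def)
  next
    case False
    obtain d where d: "d \<in> E - H" "sg X d = - y d"
      using signature_orthogonal[OF sgn X False] by blast
    have "\<not> support (opposite X) \<subseteq> H" using False by simp
    then obtain d' where d': "d' \<in> E - H" "sg (opposite X) d' = - y d'"
      using signature_orthogonal[OF sgn circuit_opposite[OF X]] by blast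
    then have "sg X d' = y d'" using sg_opposite[OF circuit_disjoint[OF X]] by simp
    then have "d' \<in> (fst X \<inter> fst Y) \<union> (snd X \<inter> snd Y)"
      using d' y[of d'] by (auto simp: Y_def sg_def split: if_splits)
    moreover have "d \<in> (fst X \<inter> snd Y) \<union> (snd X \<inter> fst Y)"
      using d y[of d] by (auto simp: Y_def sg_def split: if_splits)
    ultimately show ?thesis by (auto simp: orthogonal_def)
  qed
  moreover have "signed_set_on E Y" using s by (auto simp: signed_set_on_def Y_def)
  ultimately have "Y \<in> cocircuits M"
    using s hyperplane_unsigned_cocircuit by (simp add: cocircuits_def)
  then show thesis using that s by blast
qed

end

end

subsection \<open>Orthogonal pairs with the painting property\<close>

text \<open>
  A colouring consists of a red set \<open>R\<close>, a green set \<open>G\<close>, and signs for the other elements, which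
  are negative on \<open>A\<close> and positive elsewhere. Members of \<open>C\<close> have arbitrary signs on \<open>R\<close> and avoid \<open>G\<close>,
  members of \<open>D\<close> vice versa.
\<close>

definition matches :: "'a set \<Rightarrow> 'a set \<Rightarrow> 'a signed_set \<Rightarrow> bool" where
  "matches A R X \<longleftrightarrow> fst X \<inter> A \<subseteq> R \<and> snd X \<subseteq> A \<union> R"

text \<open>All reorientations \<open>A\<close> are built into the painting property:
  \<open>e\<close> has neither colour, so its own sign is prescribed by \<open>A\<close> as
  well.\<close>

definition minty :: "'a set \<Rightarrow> 'a signed_set set \<Rightarrow> 'a signed_set set \<Rightarrow> bool" where
  "minty E C D \<longleftrightarrow> finite E \<and> (\<forall>X\<in>C \<union> D. signed_set_on E X) \<and>
    (\<forall>X\<in>C. \<forall>Y\<in>D. orthogonal X Y) \<and>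
    (\<forall>e\<in>E. \<forall>A R G. R \<inter> G = {} \<and> e \<notin> R \<and> e \<notin> G \<longrightarrow>
      (\<exists>X\<in>C. e \<in> support X \<and> support X \<inter> G = {} \<and> matches A R X) \<or>
      (\<exists>Y\<in>D. e \<in> support Y \<and> support Y \<inter> R = {} \<and> matches A G Y))"

definition delete :: "'a \<Rightarrow> 'a signed_set set \<Rightarrow> 'a signed_set set" where
  "delete w C = {X \<in> C. w \<notin> support X}"

text \<open>No minimal supports are selected, and the empty signed set may arise from a member
  supported on \<open>w\<close>.\<close>

definition contract :: "'a \<Rightarrow> 'a signed_set set \<Rightarrow> 'a signed_set set" where
  "contract w C = (\<lambda>X. (fst X - {w}, snd X - {w})) ` C"

text \<open>The least elements of the members made positive by reorienting \<open>A\<close>. The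
  formulation without \<open>Min\<close> lets empty members contribute nothing.\<close>

definition act :: "'a::linorder signed_set set \<Rightarrow> 'a set \<Rightarrow> 'a set" where
  "act C A = {e. \<exists>X\<in>C. e \<in> support X \<and> (\<forall>f\<in>support X. e \<le> f) \<and> matches A {} X}"

section \<open>Duality, deletion and contraction of painting pairs\<close>

lemma orthogonal_commute: "orthogonal X Y \<longleftrightarrow> orthogonal Y X"
  unfolding orthogonal_def by blast

lemma mintyD:
  assumes "minty E C D"
  shows "finite E" "X \<in> C \<Longrightarrow> support X \<subseteq> E" "Y \<in> D \<Longrightarrow> support Y \<subseteq> E"
    "X \<in> C \<Longrightarrow> fst X \<inter> snd X = {}" "Y \<in> D \<Longrightarrow> fst Y \<inter> snd Y = {}"
    "X \<in> C \<Longrightarrow> Y \<in> D \<Longrightarrow> orthogonal X Y"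
  using assms by (simp_all add: minty_def signed_set_on_def ball_Un)

lemma minty_conformal:
  assumes "minty E C D" "X \<in> C" "Y \<in> D"
    and "fst X \<inter> snd Y = {}" "snd X \<inter> fst Y = {}"
  shows "support X \<inter> support Y = {}"
  using mintyD(6)[OF assms(1-3)] assms(4,5) unfolding orthogonal_def by blast

lemma minty_painting:
  assumes "minty E C D" "e \<in> E" "R \<inter> G = {}" "e \<notin> R" "e \<notin> G"
  obtains X where "X \<in> C" "e \<in> support X" "support X \<inter> G = {}" "matches A R X"
  | Y where "Y \<in> D" "e \<in> support Y" "support Y \<inter> R = {}" "matches A G Y"
  using assms unfolding minty_def by meson

lemma minty_dual:
  assumes "minty E C D"
  shows "minty E D C"
  unfolding minty_def
proof (intro conjI ballI allI impI)
  show "finite E" using mintyD(1)[OF assms] .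
next
  fix X assume "X \<in> D \<union> C"
  then show "signed_set_on E X"
    using mintyD(2-5)[OF assms] unfolding signed_set_on_def by blast
next
  fix X Y assume "X \<in> D" "Y \<in> C"
  then show "orthogonal X Y"
    using mintyD(6)[OF assms] orthogonal_commute by blast
next
  fix e A R G assume e: "e \<in> E" "R \<inter> G = {} \<and> e \<notin> R \<and> e \<notin> G"
  then have "G \<inter> R = {}" "e \<notin> R" "e \<notin> G" by auto
  from minty_painting[OF assms e(1) this(1,3,2), of A]
  show "(\<exists>X\<in>D. e \<in> support X \<and> support X \<inter> G = {} \<and> matches A R X) \<or>
      (\<exists>Y\<in>C. e \<in> support Y \<and> support Y \<inter> R = {} \<and> matches A G Y)"
    by cases blast+
qed

text \<open>The element \<open>w\<close> is painted green: a member of \<open>C\<close> then avoids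
  \<open>w\<close> and survives deletion, while a member of \<open>D\<close> has an arbitrary sign
  at \<open>w\<close>, which contraction discards.\<close>

lemma minty_delete:
  assumes M: "minty E C D"
  shows "minty (E - {w}) (delete w C) (contract w D)"
  unfolding minty_def
proof (intro conjI ballI allI impI)
  show "finite (E - {w})" using mintyD(1)[OF M] by simp
next
  fix X assume "X \<in> delete w C \<union> contract w D"
  then consider "X \<in> C" "w \<notin> support X" | Y where "Y \<in> D" "X = (fst Y - {w}, snd Y - {w})"
    by (auto simp: delete_def contract_def)
  then show "signed_set_on (E - {w}) X"
  proof cases
    case 1
    then show ?thesis using mintyD(2,4)[OF M 1(1)] by (auto simp: signed_set_on_def)
  next
    case 2
    then show ?thesis using mintyD(3,5)[OF M 2(1)] by (auto simp: signed_set_on_def support_def)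
  qed
next
  fix X Y assume X: "X \<in> delete w C" and "Y \<in> contract w D"
  then obtain Y' where Y': "Y' \<in> D" "Y = (fst Y' - {w}, snd Y' - {w})" by (auto simp: contract_def)
  have "X \<in> C" "w \<notin> support X" using X by (auto simp: delete_def)
  then show "orthogonal X Y"
    using mintyD(6)[OF M _ Y'(1), of X] Y'(2) by (auto simp: orthogonal_def support_def)
next
  fix e A R G assume e: "e \<in> E - {w}" and "R \<inter> G = {} \<and> e \<notin> R \<and> e \<notin> G"
  then have "e \<in> E" "(R - {w}) \<inter> insert w G = {}" "e \<notin> R - {w}" "e \<notin> insert w G" by auto
  from minty_painting[OF M this, of A]
  show "(\<exists>X\<in>delete w C. e \<in> support X \<and> support X \<inter> G = {} \<and> matches A R X) \<or>
      (\<exists>Y\<in>contract w D. e \<in> support Y \<and> support Y \<inter> R = {} \<and> matches A G Y)"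
  proof cases
    case (1 X)
    then have "X \<in> delete w C" "support X \<inter> G = {}" "matches A R X"
      by (auto simp: delete_def matches_def)
    then show ?thesis using 1(2) by blast
  next
    case (2 Y)
    let ?Y = "(fst Y - {w}, snd Y - {w})"
    have "?Y \<in> contract w D" using 2(1) by (auto simp: contract_def)
    moreover have "e \<in> support ?Y" "support ?Y \<inter> R = {}" "matches A G ?Y"
      using 2(2-4) e by (auto simp: matches_def support_def)
    ultimately show ?thesis by blast
  qed
qed

lemma minty_contract: "minty E C D \<Longrightarrow> minty (E - {w}) (contract w C) (delete w D)"
  by (simp add: minty_dual minty_delete)

section \<open>Activities before and after removing an element\<close>

lemma act_subset:
  assumes "minty E C D"
  shows "act C A \<subseteq> E"
  using mintyD(2)[OF assms] unfolding act_def by blast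

text \<open>A one-element support cannot provide both an agreement and a disagreement in sign, so
  orthogonality leaves only disjointness.\<close>

lemma minty_loop:
  assumes M: "minty E C D" and X: "X \<in> C" "support X = {w}" and Y: "Y \<in> D"
  shows "w \<notin> support Y"
proof -
  have "fst X \<subseteq> {w}" "snd X \<subseteq> {w}" using X(2) by (auto simp: support_def)
  then have "fst X = {} \<or> snd X = {}"
    using mintyD(4)[OF M X(1)] by (auto simp: subset_singleton_iff)
  then have "\<not> ((fst X \<inter> fst Y) \<union> (snd X \<inter> snd Y) \<noteq> {} \<and> (fst X \<inter> snd Y) \<union> (snd X \<inter> fst Y) \<noteq> {})"
    using mintyD(5)[OF M Y] \<open>fst X \<subseteq> {w}\<close> \<open>snd X \<subseteq> {w}\<close> by auto
  then show ?thesis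
    using mintyD(6)[OF M X(1) Y] X(2) by (auto simp: orthogonal_def)
qed

text \<open>As \<open>w\<close> is largest, restoring it to a member does not change a least element
  other than \<open>w\<close>; its sign there fits \<open>A\<close> or
  \<open>insert w A\<close>.\<close>

lemma act_contract:
  fixes E :: "'a::linorder set"
  assumes M: "minty E C D" and w_max: "\<And>e. e \<in> E \<Longrightarrow> e \<le> w" and "w \<notin> A"
  shows "act (contract w C) A = act C A \<union> act C (insert w A) - {w}"
proof (intro equalityI subsetI)
  fix e assume "e \<in> act (contract w C) A"
  then obtain X where X: "X \<in> C" "e \<in> support X" "e \<noteq> w" "\<forall>f\<in>support X - {w}. e \<le> f"
    "(fst X - {w}) \<inter> A = {}" "snd X - {w} \<subseteq> A"
    by (auto simp: act_def contract_def matches_def support_def)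
  have "e \<in> E" using X(2) mintyD(2)[OF M X(1)] by blast
  then have le: "\<forall>f\<in>support X. e \<le> f" using X(4) w_max by auto
  have "matches A {} X \<or> matches (insert w A) {} X"
  proof (cases "w \<in> fst X")
    case True
    then have "w \<notin> snd X" using mintyD(4)[OF M X(1)] by blast
    then have "matches A {} X" using X(5,6) assms(3) by (auto simp: matches_def)
    then show ?thesis ..
  next
    case False
    then have "matches (insert w A) {} X" using X(5,6) by (auto simp: matches_def)
    then show ?thesis ..
  qed
  then show "e \<in> act C A \<union> act C (insert w A) - {w}"
    using X(1-3) le unfolding act_def by blast
next
  fix e assume e: "e \<in> act C A \<union> act C (insert w A) - {w}"
  then obtain X where X: "X \<in> C" "e \<in> support X" "\<forall>f\<in>support X. e \<le> f"
     "matches A {} X \<or> matches (insert w A) {} X" by (auto simp: act_def)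
  let ?X = "(fst X - {w}, snd X - {w})"
  have "matches A {} ?X" using X(4) by (auto simp: matches_def)
  moreover have "e \<in> support ?X" using X(2) e by (auto simp: support_def)
  moreover have "\<forall>f\<in>support ?X. e \<le> f" using X(3) by (auto simp: support_def)
  moreover have "?X \<in> contract w C" using X(1) by (simp add: contract_def)
  ultimately show "e \<in> act (contract w C) A"
    unfolding act_def by blast
qed

text \<open>For the nontrivial inclusion, \<open>w\<close> and everything below \<open>e\<close> are
  painted green. A resulting member of \<open>C\<close> avoids \<open>w\<close> and has least
  element \<open>e\<close>. A member \<open>Y\<close> of \<open>D\<close> would have to be negative
  at \<open>w\<close> because of \<open>X\<close>, and then be conformal with \<open>X'\<close>
  although both contain \<open>e\<close>.\<close>

lemma act_delete:
  fixes E :: "'a::linorder set"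
  assumes M: "minty E C D" and "w \<notin> A"
  shows "act (delete w C) A = act C A \<inter> act C (insert w A) - {w}"
proof (intro equalityI subsetI)
  fix e assume "e \<in> act (delete w C) A"
  then obtain X where X: "X \<in> C" "w \<notin> support X" "e \<in> support X" "\<forall>f\<in>support X. e \<le> f" "matches A {} X"
    unfolding act_def delete_def by blast
  then have "matches (insert w A) {} X" by (auto simp: matches_def support_def)
  then show "e \<in> act C A \<inter> act C (insert w A) - {w}"
    using X unfolding act_def by blast
next
  fix e assume e: "e \<in> act C A \<inter> act C (insert w A) - {w}"
  then obtain X where X: "X \<in> C" "e \<in> support X" "\<forall>f\<in>support X. e \<le> f" "matches A {} X"
    unfolding act_def by blast
  obtain X' where X': "X' \<in> C" "e \<in> support X'" "\<forall>f\<in>support X'. e \<le> f" "matches (insert w A) {} X'"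
    using e unfolding act_def by blast
  let ?G = "insert w {f. f < e}"
  have "e \<in> E" "{} \<inter> ?G = {}" "e \<notin> {}" "e \<notin> ?G" using X(2) mintyD(2)[OF M X(1)] e by auto
  from minty_painting[OF M this, of A]
  show "e \<in> act (delete w C) A"
  proof cases
    case (1 Z)
    then have "w \<notin> support Z" "\<forall>f\<in>support Z. e \<le> f" by (auto simp: not_less)
    then show ?thesis
      using 1(1,2,4) unfolding act_def delete_def by blast
  next
    case (2 Y)
    have Y: "fst Y \<inter> A \<subseteq> ?G" "snd Y \<subseteq> A \<union> ?G" using 2(4) by (auto simp: matches_def)
    have "w \<in> snd Y"
    proof (rule ccontr)
      assume w: "w \<notin> snd Y"
      have "\<forall>f\<in>support X. \<not> f < e" using X(3) by (simp add: not_less)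
      then have "fst X \<inter> snd Y = {}" "snd X \<inter> fst Y = {}"
        using X(4) Y w assms(2) unfolding matches_def support_def by blast+
      then show False using minty_conformal[OF M X(1) 2(1)] X(2) 2(2) by blast
    qed
    then have w: "w \<notin> fst Y" using mintyD(5)[OF M 2(1)] by blast
    have "\<forall>f\<in>support X'. \<not> f < e" using X'(3) by (simp add: not_less)
    then have "fst X' \<inter> snd Y = {}" "snd X' \<inter> fst Y = {}"
      using X'(4) Y w unfolding matches_def support_def by blast+
    then show ?thesis using minty_conformal[OF M X'(1) 2(1)] X'(2) 2(2) by blast
  qed
qed

text \<open>
  Below \<open>A1\<close> and \<open>A2\<close> differ at most in \<open>w\<close>. The witness \<open>Y\<close> excludes \<open>w\<close> from every
  member of \<open>C\<close> that is positive for \<open>A2\<close> and has no element below \<open>e\<close>.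
\<close>

lemma act_diff_witness:
  fixes E :: "'a::linorder set"
  assumes M: "minty E C D" and A: "A1 - {w} = A2 - {w}"
    and e: "e \<in> act C A1" "e \<notin> act C A2"
  obtains Y where "Y \<in> D" "w \<in> support Y" "matches A2 {f. f < e} Y"
proof -
  obtain X where X: "X \<in> C" "e \<in> support X" "\<forall>f\<in>support X. e \<le> f" "matches A1 {} X"
    using e(1) unfolding act_def by blast
  have "e \<in> E" "{} \<inter> {f. f < e} = {}" "e \<notin> {}" "e \<notin> {f. f < e}"
    using X(2) mintyD(2)[OF M X(1)] by auto
  from minty_painting[OF M this, of A2]
  show thesis
  proof cases
    case (1 Z)
    then have "\<forall>f\<in>support Z. e \<le> f" by (auto simp: not_less)
    then have "e \<in> act C A2" using 1(1,2,4) unfolding act_def by blast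
    then show ?thesis using e(2) by blast
  next
    case (2 Y)
    have "w \<in> support Y"
    proof (rule ccontr)
      assume w: "w \<notin> support Y"
      have "\<forall>f\<in>support X. \<not> f < e" using X(3) by (simp add: not_less)
      moreover have "fst X \<inter> A2 \<subseteq> {w}" "snd X \<subseteq> insert w A2"
        using X(4) A unfolding matches_def by blast+
      moreover have "fst Y \<inter> A2 \<subseteq> {f. f < e}" "snd Y \<subseteq> A2 \<union> {f. f < e}"
        using 2(4) unfolding matches_def by blast+
      ultimately have "fst X \<inter> snd Y = {}" "snd X \<inter> fst Y = {}"
        using w unfolding support_def by blast+
      then show False using minty_conformal[OF M X(1) 2(1)] X(2) 2(2) by blast
    qed
    then show ?thesis using that[OF 2(1) _ 2(4)] by blast
  qed
qed

text \<open>The witness for \<open>e\<close> keeps \<open>w\<close> out of the member with least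
  element \<open>f\<close>, which is therefore positive for \<open>A1\<close> as well.\<close>

lemma act_nested:
  fixes E :: "'a::linorder set"
  assumes M: "minty E C D" and A: "A1 - {w} = A2 - {w}"
    and e: "e \<in> act C A1" "e \<notin> act C A2" and f: "f \<in> act C A2" "e < f"
  shows "f \<in> act C A1"
proof -
  obtain Y where Y: "Y \<in> D" "w \<in> support Y" "matches A2 {f. f < e} Y"
    by (rule act_diff_witness[OF M A e])
  obtain X where X: "X \<in> C" "f \<in> support X" "\<forall>g\<in>support X. f \<le> g" "matches A2 {} X"
    using f(1) unfolding act_def by blast
  have "\<forall>g\<in>support X. \<not> g < e" using X(3) f(2) by force
  then have "fst X \<inter> snd Y = {}" "snd X \<inter> fst Y = {}"
    using X(4) Y(3) unfolding matches_def support_def by blast+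
  then have "w \<notin> support X" using minty_conformal[OF M X(1) Y(1)] Y(2) by blast
  then have "matches A1 {} X" using X(4) A unfolding matches_def support_def by blast
  then show ?thesis using X(1-3) unfolding act_def by blast
qed

text \<open>Given an element in each difference, \<open>act_nested\<close> puts the larger one into
  both sets.\<close>

lemma act_chain:
  fixes E :: "'a::linorder set"
  assumes M: "minty E C D" and A: "A1 - {w} = A2 - {w}"
  shows "act C A1 \<subseteq> act C A2 \<or> act C A2 \<subseteq> act C A1"
proof (rule ccontr)
  assume "\<not> ?thesis"
  then obtain e f where ef: "e \<in> act C A1" "e \<notin> act C A2" "f \<in> act C A2" "f \<notin> act C A1"
    by blast
  consider "e < f" | "f < e" using ef by force
  then show False
    using act_nested[OF M A ef(1-3)] act_nested[OF M A[symmetric] ef(3,4,1)] ef by cases auto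
qed

text \<open>An activity lost in passing from \<open>A1\<close> to \<open>A2\<close> comes from a
  member through \<open>w\<close>. Losses in both \<open>C\<close> and \<open>D\<close> would give
  two members positive for \<open>A1\<close> that share \<open>w\<close>, against orthogonality.
  Hence the nestings for \<open>C\<close> and \<open>D\<close> run in opposite directions.\<close>

lemma act_diff_disjoint:
  assumes M: "minty E C D" and A: "A1 - {w} = A2 - {w}"
    and e: "e \<in> act C A1" "e \<notin> act C A2" and f: "f \<in> act D A1" "f \<notin> act D A2"
  shows False
proof -
  have sign: "\<exists>X\<in>C. w \<in> support X \<and> matches A1 {} X" if "e \<in> act C A1" "e \<notin> act C A2" for C e
  proof -
    obtain X where X: "X \<in> C" "e \<in> support X" "\<forall>g\<in>support X. e \<le> g" "matches A1 {} X"
      using \<open>e \<in> act C A1\<close> unfolding act_def by blast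
    have "w \<in> support X"
    proof (rule ccontr)
      assume "w \<notin> support X"
      then have "matches A2 {} X" using X(4) A unfolding matches_def support_def by blast
      then show False using X(1-3) that(2) unfolding act_def by blast
    qed
    then show ?thesis using X by blast
  qed
  obtain X where X: "X \<in> C" "w \<in> support X" "matches A1 {} X" using sign[OF e] by blast
  obtain Y where Y: "Y \<in> D" "w \<in> support Y" "matches A1 {} Y" using sign[OF f] by blast
  have "fst X \<inter> snd Y = {}" "snd X \<inter> fst Y = {}"
    using X(3) Y(3) unfolding matches_def by blast+
  then show False using minty_conformal[OF M X(1) Y(1)] X(2) Y(2) by blast
qed

text \<open>\<open>A1\<close> is the reorientation with the smaller activities for \<open>C\<close>
  and the larger ones for \<open>D\<close>, so intersections and unions become the sets themselves.
  Which of the two reorientations it is depends on \<open>A\<close>.\<close>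

lemma act_minors:
  fixes E :: "'a::linorder set"
  assumes M: "minty E C D" and w_max: "\<And>e. e \<in> E \<Longrightarrow> e \<le> w" and w: "w \<notin> A"
    and nl: "\<And>B. w \<notin> act C B" "\<And>B. w \<notin> act D B"
  obtains A1 A2 where "{A1, A2} = {A, insert w A}" "A1 \<noteq> A2"
    "act C A1 = act (delete w C) A" "act D A1 = act (contract w D) A"
    "act C A2 = act (contract w C) A" "act D A2 = act (delete w D) A"
proof -
  let ?B = "insert w A"
  have eq: "A - {w} = ?B - {w}" by blast
  note chain = act_chain[OF M eq] act_chain[OF minty_dual[OF M] eq]
  have "act C A \<subseteq> act C ?B \<or> act D A \<subseteq> act D ?B" "act C ?B \<subseteq> act C A \<or> act D ?B \<subseteq> act D A"
    using act_diff_disjoint[OF M eq] act_diff_disjoint[OF M eq[symmetric]] by blast+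
  with chain consider "act C A \<subseteq> act C ?B" "act D ?B \<subseteq> act D A"
    | "act C ?B \<subseteq> act C A" "act D A \<subseteq> act D ?B"
    by blast
  moreover have "act (delete w C) A = act C A \<inter> act C ?B" "act (delete w D) A = act D A \<inter> act D ?B"
    "act (contract w C) A = act C A \<union> act C ?B" "act (contract w D) A = act D A \<union> act D ?B"
    using act_delete[OF M w] act_delete[OF minty_dual[OF M] w] act_contract[OF M w_max w]
      act_contract[OF minty_dual[OF M] w_max w] nl by auto
  ultimately show thesis
  proof cases
    case 1
    then show ?thesis using \<open>act (delete w C) A = _\<close> \<open>act (delete w D) A = _\<close>
        \<open>act (contract w C) A = _\<close> \<open>act (contract w D) A = _\<close> w
      by (intro that[of A ?B]) auto
  next
    case 2
    then show ?thesis using \<open>act (delete w C) A = _\<close> \<open>act (delete w D) A = _\<close>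
        \<open>act (contract w C) A = _\<close> \<open>act (contract w D) A = _\<close> w
      by (intro that[of ?B A]) auto
  qed
qed

lemma no_loop_act:
  fixes E :: "'a::linorder set"
  assumes M: "minty E C D" and w_max: "\<And>e. e \<in> E \<Longrightarrow> e \<le> w" and "\<nexists>X. X \<in> C \<and> support X = {w}"
  shows "w \<notin> act C B"
proof
  assume "w \<in> act C B"
  then obtain X where X: "X \<in> C" "w \<in> support X" "\<forall>f\<in>support X. w \<le> f"
    unfolding act_def by blast
  then have "support X = {w}" using mintyD(2)[OF M X(1)] w_max by force
  then show False using X assms(3) by blast
qed

text \<open>The sign of \<open>L\<close> may be wrong for \<open>B\<close>; painting all other
  elements green yields a member on \<open>{w}\<close> with the right sign.\<close>

lemma loop_act:
  fixes E :: "'a::linorder set"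
  assumes M: "minty E C D" and L: "L \<in> C" "support L = {w}"
  shows "w \<in> act C B"
proof -
  have "w \<in> E" using mintyD(2)[OF M L(1)] L(2) by simp
  then show ?thesis
  proof (rule minty_painting[OF M, of w "{}" "- {w}" B])
    fix X assume X: "X \<in> C" "w \<in> support X" "support X \<inter> - {w} = {}" "matches B {} X"
    then have "support X = {w}" by blast
    then show ?thesis using X unfolding act_def by auto
  next
    fix Y assume "Y \<in> D" "w \<in> support Y"
    then show ?thesis using minty_loop[OF M L] by blast
  qed auto
qed

text \<open>A difference in the activities for \<open>C\<close> would produce a member of
  \<open>D\<close> through the loop \<open>w\<close>.\<close>

lemma loop_act_insert:
  fixes E :: "'a::linorder set"
  assumes M: "minty E C D" and L: "L \<in> C" "support L = {w}"
  shows "act C (insert w A) = act C A" "act D (insert w A) = act D A"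
proof -
  have "act C A1 \<subseteq> act C A2" if "A1 - {w} = A2 - {w}" for A1 A2
    using act_diff_witness[OF M that] minty_loop[OF M L] by blast
  then show "act C (insert w A) = act C A"
    by (intro equalityI) auto
  have "matches (insert w A) {} Y \<longleftrightarrow> matches A {} Y" if "Y \<in> D" for Y
    using minty_loop[OF M L that] by (auto simp: matches_def support_def)
  then show "act D (insert w A) = act D A" unfolding act_def by blast
qed

subsection \<open>Deletion and contraction\<close>

definition weight :: "'a::linorder signed_set set \<Rightarrow> 'a signed_set set \<Rightarrow>
    'r::comm_ring_1 \<Rightarrow> 'r \<Rightarrow> 'r \<Rightarrow> 'r \<Rightarrow> 'a set \<Rightarrow> 'r" where
  "weight C D x u y v A =
     x ^ card (act D A - A) * u ^ card (act D A \<inter> A) * y ^ card (act C A - A) * v ^ card (act C A \<inter> A)"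

lemma weight_dual: "weight C D x u y v A = weight D C y v x u A"
  by (simp add: weight_def mult_ac)

text \<open>The loop \<open>w\<close> is active for both reorientations: it lies outside
  \<open>A\<close>, giving a factor \<open>y\<close>, and inside \<open>insert w A\<close>, giving
  \<open>v\<close>.\<close>

lemma weight_loop:
  fixes E :: "'a::linorder set"
  assumes M: "minty E C D" and w_max: "\<And>e. e \<in> E \<Longrightarrow> e \<le> w" and w: "w \<notin> A"
    and L: "L \<in> C" "support L = {w}"
  shows "weight C D x u y v A + weight C D x u y v (insert w A) =
    (y + v) * weight (contract w C) (delete w D) x u y v A"
proof -
  have wa: "w \<in> act C A" using loop_act[OF M L] .
  have con: "act (contract w C) A = act C A - {w}"
    using act_contract[OF M w_max w] loop_act_insert(1)[OF M L] by simp
  have "delete w D = D" using minty_loop[OF M L] by (auto simp: delete_def)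
  then have del: "act (delete w D) A = act D A" by simp
  have wd: "w \<notin> act D A" using minty_loop[OF M L] by (auto simp: act_def)
  have fin: "finite (act C A)" using finite_subset[OF act_subset[OF M] mintyD(1)[OF M]] .
  have "act C A - A = insert w (act C A - {w} - A)" "act C A \<inter> insert w A = insert w ((act C A - {w}) \<inter> A)"
    "act C A \<inter> A = (act C A - {w}) \<inter> A" "act C A - insert w A = act C A - {w} - A"
    "act D A - insert w A = act D A - A" "act D A \<inter> insert w A = act D A \<inter> A"
    using w wa wd by auto
  then show ?thesis
    using fin w unfolding weight_def con del loop_act_insert[OF M L] by (simp add: algebra_simps)
qed

lemma weight_coloop:
  fixes E :: "'a::linorder set"
  assumes M: "minty E C D" and w_max: "\<And>e. e \<in> E \<Longrightarrow> e \<le> w" and w: "w \<notin> A"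
    and L: "L \<in> D" "support L = {w}"
  shows "weight C D x u y v A + weight C D x u y v (insert w A) =
    (x + u) * weight (delete w C) (contract w D) x u y v A"
  using weight_loop[OF minty_dual[OF M] w_max w L] by (simp add: weight_dual[of C] weight_dual[of "delete w C"])

lemma weight_minors:
  fixes E :: "'a::linorder set"
  assumes M: "minty E C D" and w_max: "\<And>e. e \<in> E \<Longrightarrow> e \<le> w" and w: "w \<notin> A"
    and nl: "\<nexists>X. X \<in> C \<and> support X = {w}" "\<nexists>X. X \<in> D \<and> support X = {w}"
  shows "weight C D x u y v A + weight C D x u y v (insert w A) =
    weight (delete w C) (contract w D) x u y v A + weight (contract w C) (delete w D) x u y v A"
proof -
  note nw = no_loop_act[OF M w_max nl(1)] no_loop_act[OF minty_dual[OF M] w_max nl(2)]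
  obtain A1 A2 where A: "{A1, A2} = {A, insert w A}" "A1 \<noteq> A2"
    "act C A1 = act (delete w C) A" "act D A1 = act (contract w D) A"
    "act C A2 = act (contract w C) A" "act D A2 = act (delete w D) A"
    using act_minors[OF M w_max w nw] by metis
  \<comment> \<open>Since \<open>w\<close> is never active, both reorientations split the activities
    in the same way as \<open>A\<close>.\<close>
  have cut: "act C B - insert w A = act C B - A" "act C B \<inter> insert w A = act C B \<inter> A"
    "act D B - insert w A = act D B - A" "act D B \<inter> insert w A = act D B \<inter> A" for B
    using nw by auto
  have B: "weight C D x u y v B = x ^ card (act D B - A) * u ^ card (act D B \<inter> A) *
      y ^ card (act C B - A) * v ^ card (act C B \<inter> A)" if "B = A \<or> B = insert w A" for B
    using that cut[of B] by (auto simp: weight_def)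
  have mem: "A1 = A \<or> A1 = insert w A" "A2 = A \<or> A2 = insert w A" using A(1) by blast+
  have 1: "weight C D x u y v A1 = weight (delete w C) (contract w D) x u y v A"
    unfolding B[OF mem(1)] A(3,4) by (simp add: weight_def)
  have 2: "weight C D x u y v A2 = weight (contract w C) (delete w D) x u y v A"
    unfolding B[OF mem(2)] A(5,6) by (simp add: weight_def)
  have "weight C D x u y v A + weight C D x u y v (insert w A) =
      weight C D x u y v A1 + weight C D x u y v A2"
    using A(1,2) by (auto simp: doubleton_eq_iff add.commute)
  then show ?thesis using 1 2 by simp
qed

section \<open>Rank functions of minors and the deletion-contraction recursion\<close>

definition rank_fun :: "'a set \<Rightarrow> 'a signed_set set \<Rightarrow> ('a set \<Rightarrow> nat) \<Rightarrow> bool" where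
  "rank_fun E C r \<longleftrightarrow> r {} = 0 \<and>
     (\<forall>A a. A \<subseteq> E \<longrightarrow> a \<in> E - A \<longrightarrow> r (insert a A) = r A + (if spans C A a then 0 else 1))"

lemma rank_fun_insert:
  "\<lbrakk>rank_fun E C r; A \<subseteq> E; a \<in> E - A\<rbrakk> \<Longrightarrow> r (insert a A) = r A + (if spans C A a then 0 else 1)"
  by (simp add: rank_fun_def)

lemma rank_fun_mono:
  assumes r: "rank_fun E C r" and "finite F" "A \<union> F \<subseteq> E"
  shows "r A \<le> r (A \<union> F)"
  using assms(2,3)
proof (induction F rule: finite_induct)
  case (insert b F)
  then have "r A \<le> r (A \<union> F)" by simp
  also have "r (A \<union> F) \<le> r (insert b (A \<union> F))"
    using rank_fun_insert[OF r, of "A \<union> F" b] insert.prems by (cases "b \<in> A \<union> F") (auto simp: insert_absorb)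
  finally show ?case by simp
qed simp

lemma rank_fun_le_card:
  assumes r: "rank_fun E C r" and "finite A" "A \<subseteq> E"
  shows "r A \<le> card A"
  using assms(2,3)
proof (induction A rule: finite_induct)
  case empty
  then show ?case using r by (simp add: rank_fun_def)
next
  case (insert a A)
  then show ?case using rank_fun_insert[OF r, of A a] by simp
qed

lemma rank_fun_delete:
  assumes r: "rank_fun E C r"
  shows "rank_fun (E - {w}) (delete w C) r"
  unfolding rank_fun_def
proof (intro conjI allI impI)
  fix A a assume A: "A \<subseteq> E - {w}" "a \<in> E - {w} - A"
  then have "spans (delete w C) A a \<longleftrightarrow> spans C A a"
    unfolding spans_def delete_def by blast
  moreover have "A \<subseteq> E" "a \<in> E - A" using A by auto
  ultimately show "r (insert a A) = r A + (if spans (delete w C) A a then 0 else 1)"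
    using rank_fun_insert[OF r] by simp
qed (use r in \<open>simp add: rank_fun_def\<close>)

lemma rank_fun_contract:
  assumes r: "rank_fun E C r" and w: "w \<in> E" and "finite E"
  shows "rank_fun (E - {w}) (contract w C) (\<lambda>A. r (insert w A) - r {w})"
  unfolding rank_fun_def
proof (intro conjI allI impI)
  fix A a assume A: "A \<subseteq> E - {w}" "a \<in> E - {w} - A"
  have *: "a \<in> support (fst X - {w}, snd X - {w}) \<and> support (fst X - {w}, snd X - {w}) \<subseteq> insert a A
      \<longleftrightarrow> a \<in> support X \<and> support X \<subseteq> insert a (insert w A)" for X
    using A by (auto simp: support_def)
  have "spans (contract w C) A a \<longleftrightarrow> spans C (insert w A) a"
    unfolding spans_def contract_def bex_simps * ..
  moreover have "insert w A \<subseteq> E" "a \<in> E - insert w A" using A w by auto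
  then have "r (insert w (insert a A)) = r (insert w A) + (if spans C (insert w A) a then 0 else 1)"
    using rank_fun_insert[OF r] insert_commute[of w a] by simp
  \<comment> \<open>This keeps the natural number subtraction from truncating.\<close>
  moreover have "r {w} \<le> r (insert w A)"
    using rank_fun_mono[OF r finite_subset[OF _ assms(3)], of A "{w}"] A w by auto
  ultimately show "r (insert w (insert a A)) - r {w} =
      r (insert w A) - r {w} + (if spans (contract w C) A a then 0 else 1)"
    by auto
qed simp

lemma sum_Pow_insert:
  assumes "finite E" "w \<notin> E"
  shows "(\<Sum>A\<in>Pow (insert w E). f A) = (\<Sum>A\<in>Pow E. f A + f (insert w A) :: 'r::comm_monoid_add)"
proof -
  have "inj_on (insert w) (Pow E)" using assms(2) by (auto simp: inj_on_def)
  moreover have "Pow E \<inter> insert w ` Pow E = {}" using assms(2) by auto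
  ultimately show ?thesis
    using assms(1) by (simp add: Pow_insert sum.union_disjoint sum.reindex sum.distrib)
qed

text \<open>Induction removes the largest element \<open>w\<close>, with \<open>C\<close>,
  \<open>D\<close> and \<open>r\<close> generalised so that the hypothesis covers both minors. On
  either side the terms for \<open>A\<close> and \<open>insert w A\<close> are taken
  together.\<close>

lemma rank_generating_eq_weight:
  fixes x u y v :: "'r::comm_ring_1"
  assumes "finite E" "minty E C D" "rank_fun E C r"
  shows "(\<Sum>A\<in>Pow E. (x + u - 1) ^ (r E - r A) * (y + v - 1) ^ (card A - r A)) =
    (\<Sum>A\<in>Pow E. weight C D x u y v A)"
  using assms
proof (induction E arbitrary: C D r rule: finite_linorder_max_induct)
  case empty
  have "act C {} = {}" "act D {} = {}"
    using act_subset[OF empty(1)] act_subset[OF minty_dual[OF empty(1)]] by auto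
  then show ?case by (simp add: weight_def)
next
  case (insert w E)
  let ?E = "insert w E"
  note M = insert.prems(1) and r = insert.prems(2)
  have wE: "w \<notin> E" and w_max: "\<And>e. e \<in> ?E \<Longrightarrow> e \<le> w"
    using insert.hyps(2) by (auto intro: less_imp_le)
  have E: "?E - {w} = E" using wE by simp
  define a b where "a = x + u - 1" and "b = y + v - 1"
  define g where "g = (\<lambda>(E::'a set) r A. a ^ (r E - r A) * b ^ (card A - r A) :: 'r)"
  define r' where "r' = (\<lambda>A. r (insert w A) - r {w})"
  have fin: "finite A" if "A \<subseteq> E" for A using that insert.hyps(1) finite_subset by blast
  have del: "(\<Sum>A\<in>Pow E. g E r A) = (\<Sum>A\<in>Pow E. weight (delete w C) (contract w D) x u y v A)"
    unfolding g_def a_def b_def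
    by (rule insert.IH) (use minty_delete[OF M, of w] rank_fun_delete[OF r, of w] E in simp_all)
  have con: "(\<Sum>A\<in>Pow E. g E r' A) = (\<Sum>A\<in>Pow E. weight (contract w C) (delete w D) x u y v A)"
    unfolding g_def a_def b_def r'_def
    by (rule insert.IH)
      (use minty_contract[OF M, of w] rank_fun_contract[OF r, of w] insert.hyps(1) E in simp_all)
  have rw: "r (insert w A) = r A + (if spans C A w then 0 else 1)" if "A \<subseteq> E" for A
    using that wE by (intro rank_fun_insert[OF r]) auto
  have r0: "r {} = 0" using r by (simp add: rank_fun_def)
  have rc: "r A \<le> card A" if "A \<subseteq> E" for A
    using rank_fun_le_card[OF r fin[OF that]] that by auto
  have rE: "r A \<le> r E" if "A \<subseteq> E" for A
    using rank_fun_mono[OF r insert.hyps(1), of A] that by (simp add: Un_absorb1 subset_insertI2)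
  consider (loop) L where "L \<in> C" "support L = {w}" | (coloop) L where "L \<in> D" "support L = {w}"
    | (neither) "\<nexists>X. X \<in> C \<and> support X = {w}" "\<nexists>X. X \<in> D \<and> support X = {w}"
    by blast
  then have "(\<Sum>A\<in>Pow E. g ?E r A + g ?E r (insert w A)) =
      (\<Sum>A\<in>Pow E. weight C D x u y v A + weight C D x u y v (insert w A))"
  proof cases
    case (loop L)
    have sp: "spans C A w" for A using loop by (auto simp: spans_def)
    \<comment> \<open>A loop changes no rank and raises the nullity by one, so the two terms have
      the common factor \<open>1 + b\<close>, which is \<open>y + v\<close>.\<close>
    have "g ?E r A + g ?E r (insert w A) = (y + v) * g E r' A" if "A \<in> Pow E" for A
    proof -
      have A: "A \<subseteq> E" "w \<notin> A" using that wE by auto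
      have "card (insert w A) - r A = Suc (card A - r A)"
        using rc[OF A(1)] A fin by (simp add: Suc_diff_le)
      then show ?thesis
        using rw[OF A(1)] rw[of E] rw[of "{}"] sp r0
        by (simp add: g_def r'_def b_def algebra_simps)
    qed
    then have "(\<Sum>A\<in>Pow E. g ?E r A + g ?E r (insert w A)) = (y + v) * (\<Sum>A\<in>Pow E. g E r' A)"
      by (simp add: sum_distrib_left)
    also have "\<dots> = (\<Sum>A\<in>Pow E. weight C D x u y v A + weight C D x u y v (insert w A))"
      unfolding con sum_distrib_left
      using wE by (intro sum.cong refl weight_loop[OF M w_max _ loop, symmetric]) auto
    finally show ?thesis .
  next
    case (coloop L)
    have "w \<notin> support X" if "X \<in> C" for X
      using minty_loop[OF minty_dual[OF M] coloop that] .
    then have sp: "\<not> spans C A w" for A by (auto simp: spans_def)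
    \<comment> \<open>Leaving out a coloop raises the corank by one, so the common factor is
      \<open>a + 1\<close>, which is \<open>x + u\<close>.\<close>
    have "g ?E r A + g ?E r (insert w A) = (x + u) * g E r A" if "A \<in> Pow E" for A
    proof -
      have A: "A \<subseteq> E" "w \<notin> A" using that wE by auto
      have "r ?E - r A = Suc (r E - r A)" "r ?E - r (insert w A) = r E - r A"
        "card (insert w A) - r (insert w A) = card A - r A"
        using rw[OF A(1)] rw[of E] sp rE[OF A(1)] A fin by (simp_all add: Suc_diff_le)
      then show ?thesis
        by (simp add: g_def a_def algebra_simps)
    qed
    then have "(\<Sum>A\<in>Pow E. g ?E r A + g ?E r (insert w A)) = (x + u) * (\<Sum>A\<in>Pow E. g E r A)"
      by (simp add: sum_distrib_left)
    also have "\<dots> = (\<Sum>A\<in>Pow E. weight C D x u y v A + weight C D x u y v (insert w A))"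
      unfolding del sum_distrib_left
      using wE by (intro sum.cong refl weight_coloop[OF M w_max _ coloop, symmetric]) auto
    finally show ?thesis .
  next
    case neither
    have "\<not> spans C {} w"
      using neither(1) unfolding spans_def by blast
    then have rw1: "r {w} = 1" using rw[of "{}"] r0 by simp
    \<comment> \<open>With all of \<open>E\<close> painted red, the alternative would be a member of
      \<open>D\<close> supported on \<open>{w}\<close>.\<close>
    have "spans C E w"
    proof (rule minty_painting[OF M, of w E "- ?E" "{}"])
      fix X assume X: "X \<in> C" "w \<in> support X"
      then show ?thesis using mintyD(2)[OF M X(1)] unfolding spans_def by blast
    next
      fix Y assume Y: "Y \<in> D" "w \<in> support Y" "support Y \<inter> E = {}"
      then have "support Y = {w}" using mintyD(3)[OF M Y(1)] by blast
      then show ?thesis using neither(2) Y(1) by blast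
    qed (use wE in auto)
    then have rE': "r ?E = r E" using rw[of E] by simp
    \<comment> \<open>The term for \<open>A\<close> belongs to the deletion and the term for
      \<open>insert w A\<close> to the contraction.\<close>
    have "g ?E r A + g ?E r (insert w A) = g E r A + g E r' A" if "A \<in> Pow E" for A
    proof -
      have A: "A \<subseteq> E" "w \<notin> A" using that wE by auto
      have "r {w} \<le> r (insert w A)"
        using rank_fun_mono[OF r fin[OF A(1)], of "{w}"] A(1) by auto
      then have "r' E - r' A = r ?E - r (insert w A)" "card A - r' A = card (insert w A) - r (insert w A)"
        using rw1 rE' A fin[OF A(1)] rE[OF A(1)] rw[OF A(1)] by (auto simp: r'_def)
      then show ?thesis by (simp add: g_def rE')
    qed
    then have "(\<Sum>A\<in>Pow E. g ?E r A + g ?E r (insert w A)) =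
        (\<Sum>A\<in>Pow E. g E r A) + (\<Sum>A\<in>Pow E. g E r' A)"
      by (simp add: sum.distrib)
    also have "\<dots> = (\<Sum>A\<in>Pow E. weight C D x u y v A + weight C D x u y v (insert w A))"
      unfolding del con sum.distrib[symmetric]
      using wE by (intro sum.cong refl weight_minors[OF M w_max _ neither, symmetric]) auto
    finally show ?thesis .
  qed
  then show ?case
    unfolding sum_Pow_insert[OF insert.hyps(1) wE] g_def a_def b_def .
qed

subsection \<open>Reorientations and the painting property of oriented matroids\<close>

lemma flip_flip [simp]: "flip A (flip A X) = X"
  by (cases X) (auto simp: flip_def)

lemma support_flip [simp]: "support (flip A X) = support X"
  by (auto simp: flip_def support_def)

lemma positive_flip: "positive (flip A X) \<longleftrightarrow> matches A {} X"
  by (auto simp: flip_def positive_def matches_def)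

lemma signed_set_on_flip [simp]: "signed_set_on E (flip A X) \<longleftrightarrow> signed_set_on E X"
  by (auto simp: signed_set_on_def flip_def support_def)

lemma orthogonal_flip: "orthogonal (flip A X) (flip A Y) \<longleftrightarrow> orthogonal X Y"
proof -
  have "(fst (flip A X) \<inter> fst (flip A Y)) \<union> (snd (flip A X) \<inter> snd (flip A Y)) =
      (fst X \<inter> fst Y) \<union> (snd X \<inter> snd Y)"
    "(fst (flip A X) \<inter> snd (flip A Y)) \<union> (snd (flip A X) \<inter> fst (flip A Y)) =
      (fst X \<inter> snd Y) \<union> (snd X \<inter> fst Y)"
    by (auto simp: flip_def)
  then show ?thesis unfolding orthogonal_def support_flip by simp
qed

lemma ground_reorient [simp]: "ground (reorient A M) = ground M"
  by (simp add: reorient_def)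

lemma circuits_reorient: "circuits (reorient A M) = flip A ` circuits M"
  by (simp add: reorient_def)

text \<open>The underlying matroid depends on supports only, and flipping both signed sets preserves
  orthogonality.\<close>

lemma cocircuits_reorient: "cocircuits (reorient A M) = flip A ` cocircuits M"
proof -
  have "indep (reorient A M) = indep M"
    by (auto simp: indep_def circuits_reorient fun_eq_iff)
  then have "unsigned_cocircuit (reorient A M) = unsigned_cocircuit M"
    by (simp add: unsigned_cocircuit_def coindep_def basis_def fun_eq_iff)
  then have mem: "Y \<in> cocircuits (reorient A M) \<longleftrightarrow> flip A Y \<in> cocircuits M" for Y
    using orthogonal_flip[of A _ "flip A Y"] by (simp add: cocircuits_def circuits_reorient)
  show ?thesis
  proof (intro equalityI subsetI)
    fix Y assume "Y \<in> cocircuits (reorient A M)"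
    then show "Y \<in> flip A ` cocircuits M"
      using mem by (intro image_eqI[of _ _ "flip A Y"]) auto
  qed (use mem in auto)
qed

lemma Min_positive_flip:
  assumes "\<And>X. X \<in> C \<Longrightarrow> finite (support X) \<and> support X \<noteq> {}"
  shows "{Min (support X) | X. X \<in> flip A ` C \<and> positive X} = act C A"
proof -
  have "{Min (support X) | X. X \<in> flip A ` C \<and> positive X} = {Min (support X) | X. X \<in> C \<and> matches A {} X}"
    unfolding positive_flip[symmetric] by (metis (no_types, lifting) imageE imageI support_flip)
  also have "\<dots> = act C A"
  proof (intro equalityI subsetI)
    fix e assume "e \<in> {Min (support X) | X. X \<in> C \<and> matches A {} X}"
    then obtain X where X: "X \<in> C" "matches A {} X" "e = Min (support X)" by blast
    then have "e \<in> support X" "\<forall>f\<in>support X. e \<le> f" using assms[OF X(1)] by auto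
    then show "e \<in> act C A" using X unfolding act_def by blast
  next
    fix e assume "e \<in> act C A"
    then obtain X where X: "X \<in> C" "e \<in> support X" "\<forall>f\<in>support X. e \<le> f" "matches A {} X"
      unfolding act_def by blast
    then have "Min (support X) = e" using assms[OF X(1)] by (intro Min_eqI) auto
    then show "e \<in> {Min (support X) | X. X \<in> C \<and> matches A {} X}" using X by blast
  qed
  finally show ?thesis .
qed

text \<open>Only the sign at \<open>e\<close> is prescribed, and one of the two opposite signed sets
  has it.\<close>

lemma opposite_matches:
  assumes "fst X \<inter> snd X = {}" "e \<in> support X" "support X \<subseteq> insert e R"
  obtains Y where "Y = X \<or> Y = opposite X" "matches A R Y"
proof (cases "e \<in> fst X \<longleftrightarrow> e \<in> A")
  case True
  then have "matches A R (opposite X)"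
    using assms by (auto simp: matches_def opposite_def support_def)
  then show ?thesis using that by blast
next
  case False
  then have "matches A R X"
    using assms by (auto simp: matches_def support_def)
  then show ?thesis using that by blast
qed

section \<open>Circuits and cocircuits as a painting pair\<close>

context om
begin

lemma cocircuit_signed: "Y \<in> cocircuits M \<Longrightarrow> signed_set_on E Y"
  by (simp add: cocircuits_def)

lemma cocircuit_opposite: "Y \<in> cocircuits M \<Longrightarrow> opposite Y \<in> cocircuits M"
  by (auto simp: cocircuits_def signed_set_on_def orthogonal_def opposite_def support_def Un_commute)

lemma cocircuit_support: "Y \<in> cocircuits M \<Longrightarrow> finite (support Y) \<and> support Y \<noteq> {}"
proof -
  assume Y: "Y \<in> cocircuits M"
  obtain B where "max_indep_in E B"
    using max_indep_extend[OF indep_empty] by blast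
  then have "coindep M {}" unfolding coindep_def basis_iff_max_indep by blast
  then have "support Y \<noteq> {}" using Y by (auto simp: cocircuits_def unsigned_cocircuit_def)
  moreover have "support Y \<subseteq> E" using cocircuit_signed[OF Y] by (simp add: signed_set_on_def)
  ultimately show ?thesis using finite_subset by blast
qed

lemma orthogonal_cocircuit: "\<lbrakk>X \<in> C; Y \<in> cocircuits M\<rbrakk> \<Longrightarrow> orthogonal X Y"
  by (simp add: cocircuits_def)

text \<open>
  Induction on the number of uncoloured elements. If colouring \<open>f\<close> red only yields a circuit with
  the wrong sign at \<open>f\<close> and colouring it green only yields a cocircuit with the wrong sign at \<open>f\<close>,
  these two are not orthogonal.
\<close>

lemma painting:
  assumes "e \<in> E" "R \<inter> G = {}" "e \<notin> R" "e \<notin> G"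
  shows "(\<exists>X\<in>C. e \<in> support X \<and> support X \<inter> G = {} \<and> matches A R X) \<or>
    (\<exists>Y\<in>cocircuits M. e \<in> support Y \<and> support Y \<inter> R = {} \<and> matches A G Y)"
  using assms(2-4)
proof (induction "card (E - R - G - {e})" arbitrary: R G rule: less_induct)
  case less
  show ?case
  proof (cases "E \<subseteq> insert e (R \<union> G)")
    case True
    \<comment> \<open>All elements but \<open>e\<close> are coloured. Either the red ones span
      \<open>e\<close>, or a hyperplane contains them and misses \<open>e\<close>; its complement
      consists of \<open>e\<close> and green elements.\<close>
    show ?thesis
    proof (cases "spans C (R \<inter> E) e")
      case True
      then obtain X where X: "X \<in> C" "e \<in> support X" "support X \<subseteq> insert e R"
        unfolding spans_def by blast
      obtain Z where "Z = X \<or> Z = opposite X" "matches A R Z"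
        by (rule opposite_matches[OF circuit_disjoint[OF X(1)] X(2,3)])
      moreover from this have "Z \<in> C" "support Z = support X"
        using X(1) circuit_opposite[OF X(1)] by auto
      moreover have "support X \<inter> G = {}" using X(3) less.prems by blast
      ultimately show ?thesis using X(2) by (intro disjI1 bexI[of _ Z]) auto
    next
      case False
      obtain H where H: "hyperplane H" "R \<inter> E \<subseteq> H" "e \<notin> H"
        using hyperplane_exists[of "R \<inter> E" e] False assms(1) less.prems by blast
      then obtain Y where Y: "Y \<in> cocircuits M" "support Y = E - H"
        using hyperplane_cocircuit[OF H(1), of e] assms(1) by blast
      then have s: "e \<in> support Y" "support Y \<subseteq> insert e G" "support Y \<inter> R = {}"
        using H(2,3) assms(1) True by blast+
      have "fst Y \<inter> snd Y = {}" using cocircuit_signed[OF Y(1)] by (simp add: signed_set_on_def)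
      then obtain Z where "Z = Y \<or> Z = opposite Y" "matches A G Z"
        by (rule opposite_matches[OF _ s(1,2)])
      moreover from this have "Z \<in> cocircuits M" "support Z = support Y"
        using Y(1) cocircuit_opposite[OF Y(1)] by auto
      ultimately show ?thesis using s by (intro disjI2 bexI[of _ Z]) auto
    qed
  next
    case False
    then obtain f where f: "f \<in> E" "f \<noteq> e" "f \<notin> R" "f \<notin> G" by blast
    have "E - insert f R - G - {e} \<subset> E - R - G - {e}" "E - R - insert f G - {e} \<subset> E - R - G - {e}"
      using f by blast+
    then have "card (E - insert f R - G - {e}) < card (E - R - G - {e})"
      "card (E - R - insert f G - {e}) < card (E - R - G - {e})"
      by (simp_all add: psubset_card_mono)
    note IH = less.hyps[OF this(1)] less.hyps[OF this(2)]
    have red: "(\<exists>X\<in>C. e \<in> support X \<and> support X \<inter> G = {} \<and> matches A (insert f R) X) \<or>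
      (\<exists>Y\<in>cocircuits M. e \<in> support Y \<and> support Y \<inter> insert f R = {} \<and> matches A G Y)"
      using less.prems f by (intro IH(1)) auto
    have green: "(\<exists>X\<in>C. e \<in> support X \<and> support X \<inter> insert f G = {} \<and> matches A R X) \<or>
      (\<exists>Y\<in>cocircuits M. e \<in> support Y \<and> support Y \<inter> R = {} \<and> matches A (insert f G) Y)"
      using less.prems f by (intro IH(2)) auto
    show ?thesis
    proof (rule ccontr)
      assume no: "\<not> ?thesis"
      then obtain X where X: "X \<in> C" "e \<in> support X" "support X \<inter> G = {}" "matches A (insert f R) X"
        using red by blast
      obtain Y where Y: "Y \<in> cocircuits M" "e \<in> support Y" "support Y \<inter> R = {}" "matches A (insert f G) Y"
        using no green by blast
      have "\<not> matches A R X" "\<not> matches A G Y" using no X Y by blast+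
      then have wrong: "f \<in> fst X \<inter> A \<or> f \<in> snd X - A" "f \<in> fst Y \<inter> A \<or> f \<in> snd Y - A"
        using X(4) Y(4) unfolding matches_def by blast+
      have d: "fst X \<inter> snd X = {}" "fst Y \<inter> snd Y = {}"
        using circuit_disjoint[OF X(1)] cocircuit_signed[OF Y(1)] by (auto simp: signed_set_on_def)
      have X': "fst X \<inter> A \<subseteq> insert f R" "snd X \<subseteq> A \<union> insert f R" "fst X \<inter> G = {}" "snd X \<inter> G = {}"
        using X(3,4) by (auto simp: matches_def support_def)
      have Y': "fst Y \<inter> A \<subseteq> insert f G" "snd Y \<subseteq> A \<union> insert f G" "fst Y \<inter> R = {}" "snd Y \<inter> R = {}"
        using Y(3,4) by (auto simp: matches_def support_def)
      \<comment> \<open>A common element other than \<open>f\<close> is uncoloured, since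
        \<open>X\<close> avoids green and \<open>Y\<close> avoids red, so both have the sign
        prescribed by \<open>A\<close> there. At \<open>f\<close> both have the wrong sign and hence
        agree too.\<close>
      have "fst X \<inter> snd Y \<subseteq> {f}"
        using X'(1,3) Y'(2,4) by blast
      moreover have "snd X \<inter> fst Y \<subseteq> {f}"
        using X'(2,4) Y'(1,3) by blast
      moreover have "f \<notin> fst X \<inter> snd Y" "f \<notin> snd X \<inter> fst Y"
        using wrong d by blast+
      ultimately have "fst X \<inter> snd Y = {}" "snd X \<inter> fst Y = {}"
        by blast+
      then show False
        using orthogonal_cocircuit[OF X(1) Y(1)] X(2) Y(2) unfolding orthogonal_def by blast
    qed
  qed
qed

lemma minty_circuits_cocircuits: "minty E C (cocircuits M)"
  unfolding minty_def
proof (intro conjI ballI allI impI)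
  fix X assume "X \<in> C \<union> cocircuits M"
  then show "signed_set_on E X"
    using circuit_support circuit_disjoint cocircuit_signed unfolding signed_set_on_def by blast
next
  fix e A R G assume "e \<in> E" "R \<inter> G = {} \<and> e \<notin> R \<and> e \<notin> G"
  then show "(\<exists>X\<in>C. e \<in> support X \<and> support X \<inter> G = {} \<and> matches A R X) \<or>
    (\<exists>Y\<in>cocircuits M. e \<in> support Y \<and> support Y \<inter> R = {} \<and> matches A G Y)"
    using painting by blast
qed (use orthogonal_cocircuit in \<open>simp_all\<close>)

lemma rank_fun_rank: "rank_fun E C (rank M)"
  unfolding rank_fun_def using rank_empty rank_insert by blast

end

theorem theorem7p4:
  fixes M :: "'a::linorder signed_system"
    and x y u v :: "'r::comm_ring_1"
  assumes "oriented_matroid M"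
  shows "tutte M (x + u) (y + v) =
    (\<Sum>A \<in> Pow (ground M).
       x ^ card (Theta_star M A) * u ^ card (Theta_star_bar M A) *
       y ^ card (Theta M A) * v ^ card (Theta_bar M A))"
proof -
  interpret om M by standard (rule assms)
  have circ: "finite (support X) \<and> support X \<noteq> {}" if "X \<in> C" for X
    using circuit_nonempty[OF that] finite_subset[OF circuit_support[OF that]] by simp
  have O: "O_act (reorient A M) = act C A" for A
    unfolding O_act_def circuits_reorient by (rule Min_positive_flip) (rule circ)
  have Os: "O_star (reorient A M) = act (cocircuits M) A" for A
    unfolding O_star_def cocircuits_reorient by (rule Min_positive_flip) (rule cocircuit_support)
  show ?thesis
    using rank_generating_eq_weight[OF finite_E minty_circuits_cocircuits rank_fun_rank, of x u y v]
    unfolding tutte_def weight_def Theta_def Theta_bar_def Theta_star_def Theta_star_bar_def O Os .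
qed

end
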